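(* Let $(T,\Sigma,\mu)$ be a complete $\sigma$-finite measure space, let $Y,Z$ be separable Banach spaces, and let $S:T\rightrightarrows Y\times Z$ be a measurable multifunction with nonempty closed values. Let $(x,y)\in\mathsf{Sel}_{\infty,1}(S)$ and suppose that $\mathsf{Sel}_{\infty,1}(S)$ satisfies the variational condition $(\mathbf V)$ at $(x,y)$. Then $$\widehat{\mathbf T}_{\mathsf{Sel}_{\infty,1}(S)}(x,y)=\{(u,v)\in L^\infty(T,Y)\times L^1(T,Z): (u(t),v(t))\in\widehat{\mathbf T}_{S(t)}(x(t),y(t))\ \text{for a.e. }t\in T\}.$$
   Context: $L^\infty(T,Y)$, $L^1(T,Z)$ are Lebesgue--Bochner spaces; $Y\times Z$ carries the norm $\|\cdot\|_Y+\|\cdot\|_Z$ and $L^\infty(T,Y)\times L^1(T,Z)$ the norm $\|\cdot\|_{L^\infty}+\|\cdot\|_{L^1}$. $\overline{\mathbf B}_X$ is the closed unit ball of a Banach space $X$. A multifunction $S:T\rightrightarrows Y\times Z$ with nonempty closed values is measurable if $\{t: S(t)\cap U\ne\emptyset\}\in\Sigma$ for every open $U\subset Y\times Z$. $$\mathsf{Sel}_{\infty,1}(S):=\{(a,b)\in L^\infty(T,Y)\times L^1(T,Z): (a(t),b(t))\in S(t)\text{ a.e.}\}.$$ Clarke tangent cone: for $C\subset X$ closed and $x\in C$, $\widehat{\mathbf T}_C(x)$ is the set of all $v\in X$ such that for every $\varepsilon>0$ there exist $\delta>0$, $\lambda>0$ such that $C\cap[y+\eta(v+\varepsilon\overline{\mathbf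 B}_X)]\ne\emptyset$ for every $y\in C\cap(x+\delta\overline{\mathbf B}_X)$ and every $\eta\in[0,\lambda]$. A set $K\subset L^1(T,Z)$ is equi-integrable if for every decreasing sequence of measurable sets $A_n\searrow\emptyset$ (up to null sets), $\sup_{k\in K}\int_{A_n}\|k(t)\|\,d\mu(t)\to0$ as $n\to\infty$. For $M>0$ set $$\mathcal U_M:=\{u\in M\,\overline{\mathbf B}_{L^\infty(T,Y)}:\ \exists v\in L^1(T,Z),\ (u(t),v(t))\in\widehat{\mathbf T}_{S(t)}(x(t),y(t))\text{ a.e.}\}.$$ Condition $(\mathbf V)$ at $(x,y)$: for every $M>0$ there exist $\delta,\lambda>0$ and an equi-integrable set $K\subset L^1(T,Z)$ such that for every $\eta\in[0,\lambda]$ $$\Big(\mathsf{Sel}_{\infty,1}(S)\cap\big((x,y)+\delta\,\overline{\mathbf B}_{L^\infty\times L^1}\big)\Big)+\eta\,(\mathcal U_M\times\{0\})\subset\mathsf{Sel}_{\infty,1}(S)-\eta\,(\{0\}\times K).$$ *)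

theory Defs
  imports
    "HOL-Analysis.Analysis"
    "HOL-Library.Function_Algebras"
    "HOL-Probability.Essential_Supremum"
begin

text \<open>Pointwise scalar multiplication: together with the instances of Function_Algebras and of
  product types it makes \<open>('t \<Rightarrow> 'y) \<times> ('t \<Rightarrow> 'z)\<close> a real vector space.\<close>

instantiation "fun" :: (type, real_vector) real_vector
begin

definition scaleR_fun :: "real \<Rightarrow> ('a \<Rightarrow> 'b) \<Rightarrow> 'a \<Rightarrow> 'b" where
  "scaleR_fun c f = (\<lambda>t. c *\<^sub>R f t)"

instance
  by standard (auto simp: scaleR_fun_def plus_fun_def fun_eq_iff algebra_simps)

end

text \<open>Normed spaces below are given by a carrier \<open>X\<close> inside a real vector space and a (semi)norm
  \<open>N\<close> on it.  This allows spaces of functions to be represented by their measurable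
  representatives (functions equal almost everywhere are at distance 0), and it allows \<open>Y \<times> Z\<close>
  to carry the sum norm, which is not the norm of the product type.\<close>

definition ball_on :: "'x::real_vector set \<Rightarrow> ('x \<Rightarrow> real) \<Rightarrow> 'x \<Rightarrow> real \<Rightarrow> 'x set" where
  "ball_on X N c r = {c + r *\<^sub>R w | w. w \<in> X \<and> N w \<le> 1}"

definition clarke_tangent_cone ::
  "'x::real_vector set \<Rightarrow> ('x \<Rightarrow> real) \<Rightarrow> 'x set \<Rightarrow> 'x \<Rightarrow> 'x set" where
  "clarke_tangent_cone X N C x =
     {v \<in> X. \<forall>\<epsilon>>0. \<exists>\<delta>>0. \<exists>\<kappa>>0. \<forall>y \<in> C \<inter> ball_on X N x \<delta>. \<forall>\<eta>\<in>{0..\<kappa>}.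
        C \<inter> {y + \<eta> *\<^sub>R w | w. w \<in> ball_on X N v \<epsilon>} \<noteq> {}}"

definition sum_norm :: "'y::real_normed_vector \<times> 'z::real_normed_vector \<Rightarrow> real" where
  "sum_norm p = norm (fst p) + norm (snd p)"

text \<open>In a separable Banach space, Borel measurability is the same as strong measurability.\<close>

definition Linf :: "'t measure \<Rightarrow> ('t \<Rightarrow> 'y::{banach, second_countable_topology}) set" where
  "Linf M = {u \<in> borel_measurable M. esssup M (\<lambda>t. ennreal (norm (u t))) < \<infinity>}"

definition Linf_norm :: "'t measure \<Rightarrow> ('t \<Rightarrow> 'y::{banach, second_countable_topology}) \<Rightarrow> real" where
  "Linf_norm M u = enn2real (esssup M (\<lambda>t. ennreal (norm (u t))))"

definition L1 :: "'t measure \<Rightarrow> ('t \<Rightarrow> 'z::{banach, second_countable_topology}) set" where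
  "L1 M = {v. integrable M v}"

definition L1_norm :: "'t measure \<Rightarrow> ('t \<Rightarrow> 'z::{banach, second_countable_topology}) \<Rightarrow> real" where
  "L1_norm M v = (\<integral>t. norm (v t) \<partial>M)"

definition LinfL1_norm ::
  "'t measure \<Rightarrow> ('t \<Rightarrow> 'y::{banach, second_countable_topology}) \<times>
                 ('t \<Rightarrow> 'z::{banach, second_countable_topology}) \<Rightarrow> real" where
  "LinfL1_norm M p = Linf_norm M (fst p) + L1_norm M (snd p)"

definition measurable_multifunction :: "'t measure \<Rightarrow> ('t \<Rightarrow> 'x::topological_space set) \<Rightarrow> bool" where
  "measurable_multifunction M S \<longleftrightarrow>
     (\<forall>U. open U \<longrightarrow> {t \<in> space M. S t \<inter> U \<noteq> {}} \<in> sets M)"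

definition Sel ::
  "'t measure \<Rightarrow> ('t \<Rightarrow> ('y::{banach, second_countable_topology} \<times>
                       'z::{banach, second_countable_topology}) set) \<Rightarrow>
   (('t \<Rightarrow> 'y) \<times> ('t \<Rightarrow> 'z)) set" where
  "Sel M S = {(a, b) \<in> Linf M \<times> L1 M. AE t in M. (a t, b t) \<in> S t}"

text \<open>\<open>A\<^sub>n\<close> decreases to the empty set up to a null set.  The supremum is taken in the extended
  nonnegative reals, so it may be infinite for finitely many (or, a priori, all) \<open>n\<close>.\<close>

definition equi_integrable ::
  "'t measure \<Rightarrow> ('t \<Rightarrow> 'z::{banach, second_countable_topology}) set \<Rightarrow> bool" where
  "equi_integrable M K \<longleftrightarrow>
     (\<forall>A :: nat \<Rightarrow> 't set. range A \<subseteq> sets M \<and> decseq A \<and> (\<Inter>n. A n) \<in> null_sets M \<longrightarrow>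
        (\<lambda>n. SUP k\<in>K. \<integral>\<^sup>+t\<in>A n. ennreal (norm (k t)) \<partial>M) \<longlonglongrightarrow> 0)"

definition U_set ::
  "'t measure \<Rightarrow> ('t \<Rightarrow> ('y::{banach, second_countable_topology} \<times>
                       'z::{banach, second_countable_topology}) set) \<Rightarrow>
   ('t \<Rightarrow> 'y) \<Rightarrow> ('t \<Rightarrow> 'z) \<Rightarrow> real \<Rightarrow> ('t \<Rightarrow> 'y) set" where
  "U_set M S x y m =
     {u \<in> ball_on (Linf M) (Linf_norm M) 0 m.
        \<exists>v \<in> L1 M. AE t in M.
          (u t, v t) \<in> clarke_tangent_cone UNIV sum_norm (S t) (x t, y t)}"

definition condition_V ::
  "'t measure \<Rightarrow> ('t \<Rightarrow> ('y::{banach, second_countable_topology} \<times>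
                       'z::{banach, second_countable_topology}) set) \<Rightarrow>
   ('t \<Rightarrow> 'y) \<Rightarrow> ('t \<Rightarrow> 'z) \<Rightarrow> bool" where
  "condition_V M S x y \<longleftrightarrow>
     (\<forall>m>0. \<exists>\<delta>>0. \<exists>\<kappa>>0. \<exists>K \<subseteq> L1 M. equi_integrable M K \<and>
        (\<forall>\<eta>\<in>{0..\<kappa>}.
           {p + \<eta> *\<^sub>R (u, 0) | p u.
              p \<in> Sel M S \<inter> ball_on (Linf M \<times> L1 M) (LinfL1_norm M) (x, y) \<delta> \<and>
              u \<in> U_set M S x y m}
           \<subseteq> {q - \<eta> *\<^sub>R (0, k) | q k. q \<in> Sel M S \<and> k \<in> K}))"

end

(* If a direction z is not tangent to S t, then there is c > 0 such that for every radius and all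
   large k some point q of S t within that radius of the base point satisfies
   dist (q + z/k, S t) > c/k, since otherwise iterating small corrected steps would yield all steps.  If this
   happened on a set of positive measure, moving the base selection there to such points would
   contradict tangency in the space of selections.  Conversely, if z is pointwise tangent, the
   parameters at which steps of length at most 1/n can be corrected with relative error h t
   (h positive and integrable) exhaust T as n grows.  On those one corrects pointwise by a
   measurable choice; on the rest, and where the given selection is far from the base one,
   condition (V) provides a correction with error in K, small by equi-integrability. *)
theory Submission
  imports Defs
begin

text \<open>The mixed norm is the obstacle: an error that is large only on a set of small measure
  may be harmless in \<open>L1\<close> but never in \<open>Linf\<close>. Going from selections to
  points, this works against a supposed correction: its \<open>Linf\<close> part is uniformly below
  the pointwise gap, so the gap must reappear in the \<open>L1\<close> part, where it can be
  integrated. Going from points to selections, it explains the shape of (V): on the exceptional set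
  the given selection cannot just be kept, since the \<open>Y\<close> error would be
  \<open>\<eta> * norm (u t)\<close>. Condition (V) moves the \<open>Y\<close> component by exactly
  \<open>\<eta> *\<^sub>R u\<close> and puts the whole error into the \<open>Z\<close> component. As
  \<open>K\<close> depends neither on the selection nor on the step, one exceptional set serves all
  of them. The measure may be infinite, so pointwise tolerances are multiples of an integrable
  \<open>h\<close> with \<open>0 < h t \<le> 1\<close>; such errors are bounded and integrable at
  once. Measurability comes from a dense sequence \<open>d\<close> of selections: conditions on
  \<open>S t\<close> become countable conditions on the \<open>d i t\<close>, and a measurable
  choice is a least index.\<close>

section \<open>Balls and Clarke tangent cones for a seminorm on a carrier\<close>

text \<open>Positivity of \<open>r\<close> matters: for \<open>r = 0\<close> the left side contains
  at most the centre, while a seminorm ball of radius 0 may contain further points.\<close>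

lemma mem_ball_on_iff:
  assumes "subspace X" and N: "\<And>c w. w \<in> X \<Longrightarrow> N (c *\<^sub>R w) = \<bar>c\<bar> * N w" and r: "r > 0"
  shows "p \<in> ball_on X N c r \<longleftrightarrow> p - c \<in> X \<and> N (p - c) \<le> r"
proof
  assume "p \<in> ball_on X N c r"
  then obtain w where w: "p = c + r *\<^sub>R w" "w \<in> X" "N w \<le> 1"
    by (auto simp: ball_on_def)
  have "r * N w \<le> r * 1" using w(3) r by (intro mult_left_mono) auto
  then show "p - c \<in> X \<and> N (p - c) \<le> r"
    using w r by (simp add: subspace_scale[OF assms(1)] N)
next
  assume p: "p - c \<in> X \<and> N (p - c) \<le> r"
  show "p \<in> ball_on X N c r"
    unfolding ball_on_def
  proof (intro CollectI exI conjI)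
    show "p = c + r *\<^sub>R ((1 / r) *\<^sub>R (p - c))" using r by simp
    show "(1 / r) *\<^sub>R (p - c) \<in> X" using p by (blast intro: subspace_scale[OF assms(1)])
    show "N ((1 / r) *\<^sub>R (p - c)) \<le> 1" using p r by (subst N) (auto simp: field_simps)
  qed
qed

text \<open>Putting the endpoint \<open>s = p + \<eta> *\<^sub>R w\<close> in place of the direction
  \<open>w\<close> turns tangency into an estimate of the residual
  \<open>s - p - \<eta> *\<^sub>R v\<close>. The residual must also be asked to lie in
  \<open>X\<close>, since for function spaces the ambient type is larger than the carrier.\<close>

lemma clarke_tangent_cone_iff:
  assumes X: "subspace X" and N: "\<And>c w. w \<in> X \<Longrightarrow> N (c *\<^sub>R w) = \<bar>c\<bar> * N w"
  shows "v \<in> clarke_tangent_cone X N C x \<longleftrightarrow>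
    v \<in> X \<and> (\<forall>\<epsilon>>0. \<exists>\<delta>>0. \<exists>\<kappa>>0. \<forall>p\<in>C. p - x \<in> X \<longrightarrow> N (p - x) \<le> \<delta> \<longrightarrow>
      (\<forall>\<eta>\<in>{0..\<kappa>}. \<exists>s\<in>C. s - p - \<eta> *\<^sub>R v \<in> X \<and> N (s - p - \<eta> *\<^sub>R v) \<le> \<eta> * \<epsilon>))"
proof -
  have N0: "N 0 = 0" using N[of 0 0] subspace_0[OF X] by simp
  have step: "C \<inter> {p + \<eta> *\<^sub>R w | w. w \<in> ball_on X N v \<epsilon>} \<noteq> {} \<longleftrightarrow>
      (\<exists>s\<in>C. s - p - \<eta> *\<^sub>R v \<in> X \<and> N (s - p - \<eta> *\<^sub>R v) \<le> \<eta> * \<epsilon>)" (is "?L \<longleftrightarrow> ?R")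
    if "p \<in> C" "\<eta> \<ge> 0" "\<epsilon> > 0" for p \<eta> \<epsilon>
  proof
    assume ?L
    then obtain w where w: "p + \<eta> *\<^sub>R w \<in> C" "w - v \<in> X" "N (w - v) \<le> \<epsilon>"
      by (auto simp: mem_ball_on_iff[OF X N \<open>\<epsilon> > 0\<close>])
    have "(p + \<eta> *\<^sub>R w) - p - \<eta> *\<^sub>R v = \<eta> *\<^sub>R (w - v)" by (simp add: algebra_simps)
    with w that show ?R
      by (intro bexI[OF _ w(1)]) (simp add: subspace_scale[OF X] N mult_left_mono)
  next
    assume ?R
    then obtain s where s: "s \<in> C" "s - p - \<eta> *\<^sub>R v \<in> X" "N (s - p - \<eta> *\<^sub>R v) \<le> \<eta> * \<epsilon>"
      by blast
    show ?L
    proof (cases "\<eta> = 0")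
      case True
      \<comment> \<open>No direction can be recovered from \<open>s\<close> by division here, but
        every direction leaves \<open>p\<close> in place, so \<open>v\<close> itself is a
        witness.\<close>
      have "v \<in> ball_on X N v \<epsilon>"
        using \<open>\<epsilon> > 0\<close> subspace_0[OF X] by (simp add: mem_ball_on_iff[OF X N \<open>\<epsilon> > 0\<close>] N0)
      then show ?thesis using True that by auto
    next
      case False
      define w where "w = (1 / \<eta>) *\<^sub>R (s - p)"
      have eq: "w - v = (1 / \<eta>) *\<^sub>R (s - p - \<eta> *\<^sub>R v)"
        using False by (simp add: w_def algebra_simps)
      have "w - v \<in> X" unfolding eq using s by (blast intro: subspace_scale[OF X])
      moreover have "N (w - v) \<le> \<epsilon>"
        unfolding eq using s False that by (subst N) (auto simp: field_simps)
      ultimately have "w \<in> ball_on X N v \<epsilon>"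
        by (simp add: mem_ball_on_iff[OF X N \<open>\<epsilon> > 0\<close>])
      moreover have "p + \<eta> *\<^sub>R w = s" using False by (simp add: w_def)
      ultimately show ?thesis using s by blast
    qed
  qed
  define P where "P \<epsilon> \<delta> \<kappa> \<longleftrightarrow> (\<forall>y \<in> C \<inter> ball_on X N x \<delta>. \<forall>\<eta>\<in>{0..\<kappa>::real}.
    C \<inter> {y + \<eta> *\<^sub>R w | w. w \<in> ball_on X N v \<epsilon>} \<noteq> {})" for \<epsilon> \<delta> \<kappa>
  define Q where "Q \<epsilon> \<delta> \<kappa> \<longleftrightarrow> (\<forall>p\<in>C. p - x \<in> X \<longrightarrow> N (p - x) \<le> \<delta> \<longrightarrow>
    (\<forall>\<eta>\<in>{0..\<kappa>}. \<exists>s\<in>C. s - p - \<eta> *\<^sub>R v \<in> X \<and> N (s - p - \<eta> *\<^sub>R v) \<le> \<eta> * \<epsilon>))" for \<epsilon> \<delta> \<kappa>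
  have "P \<epsilon> \<delta> \<kappa> \<longleftrightarrow> Q \<epsilon> \<delta> \<kappa>" if "\<epsilon> > 0" "\<delta> > 0" for \<epsilon> \<delta> \<kappa>
  proof -
    have ball: "p \<in> ball_on X N x \<delta> \<longleftrightarrow> p - x \<in> X \<and> N (p - x) \<le> \<delta>" for p
      using X N \<open>\<delta> > 0\<close> by (rule mem_ball_on_iff)
    have "P \<epsilon> \<delta> \<kappa> \<longleftrightarrow> (\<forall>y \<in> C \<inter> ball_on X N x \<delta>. \<forall>\<eta>\<in>{0..\<kappa>}.
        \<exists>s\<in>C. s - y - \<eta> *\<^sub>R v \<in> X \<and> N (s - y - \<eta> *\<^sub>R v) \<le> \<eta> * \<epsilon>)"
      unfolding P_def by (intro ball_cong refl step) (use that in auto)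
    also have "\<dots> \<longleftrightarrow> Q \<epsilon> \<delta> \<kappa>"
      unfolding Q_def Int_iff Ball_def ball by (simp only: imp_conjL)
    finally show ?thesis .
  qed
  then show ?thesis
    unfolding clarke_tangent_cone_def mem_Collect_eq P_def[symmetric] Q_def[symmetric]
    by (simp cong: conj_cong imp_cong)
qed

lemma sum_norm_scaleR: "sum_norm (c *\<^sub>R p) = \<bar>c\<bar> * sum_norm p"
  by (simp add: sum_norm_def algebra_simps)

lemma sum_norm_triangle: "sum_norm (p + q) \<le> sum_norm p + sum_norm q"
  using norm_triangle_ineq[of "fst p" "fst q"] norm_triangle_ineq[of "snd p" "snd q"]
  by (simp add: sum_norm_def)

lemma sum_norm_triangle_le: "sum_norm p \<le> a \<Longrightarrow> sum_norm q \<le> b \<Longrightarrow> sum_norm (p + q) \<le> a + b"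
  using sum_norm_triangle[of p q] by linarith

lemma sum_norm_nonneg [simp]: "0 \<le> sum_norm p"
  by (simp add: sum_norm_def)

lemma sum_norm_0 [simp]: "sum_norm 0 = 0"
  by (simp add: sum_norm_def)

lemma sum_norm_le_norm: "sum_norm p \<le> 2 * norm p"
  using norm_fst_le[of "fst p" "snd p"] norm_snd_le[of "snd p" "fst p"] by (simp add: sum_norm_def)

lemma norm_fst_le_sum_norm: "norm (fst p) \<le> sum_norm p"
  and norm_snd_le_sum_norm: "norm (snd p) \<le> sum_norm p"
  by (simp_all add: sum_norm_def)

lemma borel_measurable_sum_norm [measurable]:
  "sum_norm \<in> borel_measurable (borel :: ('y::real_normed_vector \<times> 'z::real_normed_vector) measure)"
  unfolding sum_norm_def by (intro borel_measurable_continuous_onI continuous_intros)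

lemma clarke_tangent_cone_sum_norm_iff:
  "z \<in> clarke_tangent_cone UNIV sum_norm C z0 \<longleftrightarrow>
    (\<forall>\<epsilon>>0. \<exists>\<delta>>0. \<exists>\<kappa>>0. \<forall>q\<in>C. sum_norm (q - z0) \<le> \<delta> \<longrightarrow>
      (\<forall>\<eta>\<in>{0..\<kappa>}. \<exists>s\<in>C. sum_norm (s - q - \<eta> *\<^sub>R z) \<le> \<eta> * \<epsilon>))"
  by (subst clarke_tangent_cone_iff) (auto simp: sum_norm_scaleR)

section \<open>The seminormed spaces \<open>Linf\<close> and \<open>L1\<close>\<close>

lemma Linf_bound:
  assumes [measurable]: "u \<in> borel_measurable M" and "AE t in M. norm (u t) \<le> c" and "c \<ge> 0"
  shows "u \<in> Linf M" and "Linf_norm M u \<le> c"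
proof -
  have "esssup M (\<lambda>t. ennreal (norm (u t))) \<le> ennreal c"
    by (rule esssup_I) (use assms in \<open>auto simp: ennreal_leI\<close>)
  then show "u \<in> Linf M" "Linf_norm M u \<le> c"
    using \<open>c \<ge> 0\<close>
    by (auto simp: Linf_def Linf_norm_def intro: le_less_trans[OF _ ennreal_less_top] enn2real_leI)
qed

lemma AE_norm_le_Linf_norm:
  assumes "u \<in> Linf M"
  shows "AE t in M. norm (u t) \<le> Linf_norm M u"
proof -
  have "esssup M (\<lambda>t. ennreal (norm (u t))) < \<infinity>" using assms by (simp add: Linf_def)
  moreover have "AE t in M. ennreal (norm (u t)) \<le> esssup M (\<lambda>t. ennreal (norm (u t)))"
    by (rule esssup_AE)
  ultimately show ?thesis
    by (auto simp: Linf_norm_def ennreal_le_iff elim!: eventually_mono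
        dest!: enn2real_mono)
qed

lemma Linf_norm_nonneg [simp]: "0 \<le> Linf_norm M u"
  by (simp add: Linf_norm_def)

lemma L1_norm_nonneg [simp]: "0 \<le> L1_norm M v"
  by (simp add: L1_norm_def)

lemma Linf_measurable: "u \<in> Linf M \<Longrightarrow> u \<in> borel_measurable M"
  by (simp add: Linf_def)

lemma subspace_Linf: "subspace (Linf M)"
proof (intro subspaceI)
  show "0 \<in> Linf M"
    by (rule Linf_bound(1)[of _ _ 0]) (simp_all add: zero_fun_def)
  fix u u' :: "'a \<Rightarrow> 'b" and c :: real
  assume u: "u \<in> Linf M"
  show "c *\<^sub>R u \<in> Linf M"
  proof (rule Linf_bound)
    show "c *\<^sub>R u \<in> borel_measurable M" using u[THEN Linf_measurable] by (simp add: scaleR_fun_def)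
    show "AE t in M. norm ((c *\<^sub>R u) t) \<le> \<bar>c\<bar> * Linf_norm M u"
      using u[THEN AE_norm_le_Linf_norm]
      by eventually_elim (simp add: scaleR_fun_def mult_left_mono)
  qed simp
  assume u': "u' \<in> Linf M"
  show "u + u' \<in> Linf M"
  proof (rule Linf_bound)
    show "u + u' \<in> borel_measurable M"
      using u[THEN Linf_measurable] u'[THEN Linf_measurable] by (simp add: plus_fun_def)
    show "AE t in M. norm ((u + u') t) \<le> Linf_norm M u + Linf_norm M u'"
      using u[THEN AE_norm_le_Linf_norm] u'[THEN AE_norm_le_Linf_norm]
      by eventually_elim (auto intro: norm_triangle_le)
  qed simp
qed

lemma subspace_L1: "subspace (L1 M)"
  by (auto simp: subspace_def L1_def plus_fun_def scaleR_fun_def zero_fun_def)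

lemma subspace_LinfL1: "subspace (Linf M \<times> L1 M)"
  by (intro subspace_Times subspace_Linf subspace_L1)

lemma Linf_norm_scaleR:
  assumes "u \<in> Linf M"
  shows "Linf_norm M (c *\<^sub>R u) = \<bar>c\<bar> * Linf_norm M u"
proof -
  have le: "Linf_norm M (c *\<^sub>R u) \<le> \<bar>c\<bar> * Linf_norm M u" if "u \<in> Linf M"
    for c and u :: "'a \<Rightarrow> 'b"
  proof (rule Linf_bound)
    show "c *\<^sub>R u \<in> borel_measurable M" using that[THEN Linf_measurable] by (simp add: scaleR_fun_def)
    show "AE t in M. norm ((c *\<^sub>R u) t) \<le> \<bar>c\<bar> * Linf_norm M u"
      using that[THEN AE_norm_le_Linf_norm]
      by eventually_elim (simp add: scaleR_fun_def mult_left_mono)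
  qed simp
  show ?thesis
  proof (cases "c = 0")
    case True
    then show ?thesis using le[OF assms, of 0] Linf_norm_nonneg[of M "0 *\<^sub>R u"]
      by (simp del: Linf_norm_nonneg)
  next
    case False
    have "c *\<^sub>R u \<in> Linf M"
      using assms by (rule subspace_scale[OF subspace_Linf])
    from le[OF this, of "1 / c"] False have "Linf_norm M u \<le> Linf_norm M (c *\<^sub>R u) / \<bar>c\<bar>"
      by simp
    with le[OF assms, of c] False show ?thesis by (simp add: field_simps)
  qed
qed

lemma LinfL1_norm_scaleR:
  assumes "p \<in> Linf M \<times> L1 M"
  shows "LinfL1_norm M (c *\<^sub>R p) = \<bar>c\<bar> * LinfL1_norm M p"
  using assms Linf_norm_scaleR[of "fst p" M c]
  by (auto simp: LinfL1_norm_def L1_norm_def scaleR_fun_def algebra_simps)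

section \<open>Tangency from steps of length 1/k\<close>

text \<open>A step of length \<open>\<eta>\<close> is a chain of about \<open>\<eta> * k\<close>
  steps of length \<open>1 / k\<close>, whose errors add up to a fraction of \<open>\<eta>\<close>.
  Only arbitrarily large \<open>k\<close> are demanded, so that for a nontangent \<open>z\<close>
  the negation provides a violation for all large \<open>k\<close>; this is what makes a limit in
  \<open>k\<close> possible later.\<close>

lemma clarke_tangent_cone_sum_normI:
  assumes steps: "\<And>e. e > 0 \<Longrightarrow> \<exists>d>0. \<forall>k0. \<exists>k\<ge>k0. k > 0 \<and>
    (\<forall>q\<in>C. sum_norm (q - z0) < d \<longrightarrow> (\<exists>s\<in>C. sum_norm (s - q - (1 / real k) *\<^sub>R z) \<le> e / real k))"
  shows "z \<in> clarke_tangent_cone UNIV sum_norm C z0"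
  unfolding clarke_tangent_cone_sum_norm_iff
proof (intro allI impI)
  fix e :: real assume "e > 0"
  obtain d where d: "d > 0" and step: "\<And>k0. \<exists>k\<ge>k0. k > 0 \<and> (\<forall>q\<in>C. sum_norm (q - z0) < d \<longrightarrow>
      (\<exists>s\<in>C. sum_norm (s - q - (1 / real k) *\<^sub>R z) \<le> (e / 2) / real k))"
    using steps[of "e / 2"] \<open>e > 0\<close> by auto
  \<comment> \<open>Chosen so that \<open>\<kappa> * (sum_norm z + e) = d / 4\<close>: a chain of
    total length at most \<open>\<kappa>\<close> starting within \<open>d / 4\<close> of
    \<open>z0\<close> stays within \<open>d / 2\<close>, where the one-step hypothesis keeps
    applying.\<close>
  define \<kappa> where "\<kappa> = d / (4 * (sum_norm z + e))"
  have ze: "sum_norm z + e > 0" using \<open>e > 0\<close> by (simp add: add_nonneg_pos)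
  have "\<kappa> > 0" using d ze by (simp add: \<kappa>_def)
  have "\<exists>s\<in>C. sum_norm (s - q - \<eta> *\<^sub>R z) \<le> \<eta> * e"
    if q: "q \<in> C" "sum_norm (q - z0) \<le> d / 4" and \<eta>: "\<eta> \<in> {0..\<kappa>}" for q \<eta>
  proof (cases "\<eta> = 0")
    case True
    then show ?thesis using q by (intro bexI[of _ q]) auto
  next
    case False
    with \<eta> have "\<eta> > 0" "\<eta> \<le> \<kappa>" by auto
    \<comment> \<open>The part of \<open>\<eta>\<close> not covered by whole steps is shorter than
      \<open>1 / k\<close>; this bound on \<open>k\<close> makes its cost
      \<open>sum_norm z / k\<close> at most \<open>\<eta> * e / 2\<close>, the other half of the
      error.\<close>
    obtain k where k: "k \<ge> nat \<lceil>2 * sum_norm z / (\<eta> * e)\<rceil>" "k > 0"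
      and stepk: "\<And>q. q \<in> C \<Longrightarrow> sum_norm (q - z0) < d \<Longrightarrow>
        \<exists>s\<in>C. sum_norm (s - q - (1 / real k) *\<^sub>R z) \<le> (e / 2) / real k"
      using step[of "nat \<lceil>2 * sum_norm z / (\<eta> * e)\<rceil>"] by blast
    define n where "n = nat \<lfloor>\<eta> * real k\<rfloor>"
    have "\<eta> * real k \<ge> 0" using \<open>\<eta> > 0\<close> by simp
    then have n: "real n \<le> \<eta> * real k" "\<eta> * real k < real n + 1"
      unfolding n_def by linarith+
    have "j \<le> n \<longrightarrow> (\<exists>s\<in>C. sum_norm (s - q - (real j / real k) *\<^sub>R z) \<le> real j / real k * (e / 2))" for j
    proof (induction j)
      case 0
      then show ?case using q by (auto intro!: bexI[of _ q])
    next
      case (Suc j)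
      show ?case
      proof
        assume j: "Suc j \<le> n"
        then obtain s where s: "s \<in> C"
          "sum_norm (s - q - (real j / real k) *\<^sub>R z) \<le> real j / real k * (e / 2)"
          using Suc by auto
        have jk: "real j / real k \<le> \<eta>" using j n k(2) by (simp add: field_simps)
        have "sum_norm ((s - q - (real j / real k) *\<^sub>R z) + ((real j / real k) *\<^sub>R z + (q - z0)))
            \<le> real j / real k * (e / 2) + (real j / real k * sum_norm z + d / 4)"
          using s q by (intro sum_norm_triangle_le) (simp_all add: sum_norm_scaleR)
        then have "sum_norm (s - z0) \<le> real j / real k * (e / 2) + (real j / real k * sum_norm z + d / 4)"
          by simp
        also have "\<dots> \<le> \<eta> * (e / 2) + (\<eta> * sum_norm z + d / 4)"
          using jk \<open>e > 0\<close> by (intro add_mono mult_right_mono) auto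
        also have "\<dots> \<le> \<eta> * (sum_norm z + e) + d / 4"
          using \<open>\<eta> > 0\<close> \<open>e > 0\<close> by (simp add: algebra_simps)
        also have "\<dots> \<le> \<kappa> * (sum_norm z + e) + d / 4"
          using \<open>\<eta> \<le> \<kappa>\<close> ze by simp
        also have "\<dots> = d / 4 + d / 4" using ze by (simp add: \<kappa>_def field_simps)
        also have "\<dots> < d" using d by simp
        finally obtain s' where s': "s' \<in> C" "sum_norm (s' - s - (1 / real k) *\<^sub>R z) \<le> (e / 2) / real k"
          using stepk s(1) by blast
        have "s' - q - (real (Suc j) / real k) *\<^sub>R z =
            (s' - s - (1 / real k) *\<^sub>R z) + (s - q - (real j / real k) *\<^sub>R z)"
          by (simp add: add_divide_distrib scaleR_left_distrib)
        also have "sum_norm \<dots> \<le> (e / 2) / real k + real j / real k * (e / 2)"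
          using s'(2) s(2) by (rule sum_norm_triangle_le)
        also have "\<dots> = real (Suc j) / real k * (e / 2)"
          by (simp add: add_divide_distrib algebra_simps)
        finally show "\<exists>s\<in>C. sum_norm (s - q - (real (Suc j) / real k) *\<^sub>R z) \<le> real (Suc j) / real k * (e / 2)"
          using s' by blast
      qed
    qed
    then obtain s where s: "s \<in> C"
      "sum_norm (s - q - (real n / real k) *\<^sub>R z) \<le> real n / real k * (e / 2)" by blast
    have "real n / real k \<le> \<eta>" "\<eta> \<le> (real n + 1) / real k"
      using n k(2) by (simp_all add: field_simps)
    then have nk: "real n / real k \<le> \<eta>" "\<bar>real n / real k - \<eta>\<bar> \<le> 1 / real k"
      by (simp_all add: add_divide_distrib)
    have "2 * sum_norm z / (\<eta> * e) \<le> real k" using k(1) by linarith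
    then have kz: "1 / real k * sum_norm z \<le> \<eta> * (e / 2)"
      using \<open>\<eta> > 0\<close> \<open>e > 0\<close> k(2) by (simp add: field_simps)
    have "\<bar>real n / real k - \<eta>\<bar> * sum_norm z \<le> 1 / real k * sum_norm z"
      using nk(2) by (rule mult_right_mono) simp
    then have nz: "sum_norm ((real n / real k - \<eta>) *\<^sub>R z) \<le> \<eta> * (e / 2)"
      unfolding sum_norm_scaleR using kz by (rule order_trans)
    have "s - q - \<eta> *\<^sub>R z = (s - q - (real n / real k) *\<^sub>R z) + (real n / real k - \<eta>) *\<^sub>R z"
      by (simp add: algebra_simps)
    also have "sum_norm \<dots> \<le> real n / real k * (e / 2) + \<eta> * (e / 2)"
      using s(2) nz by (rule sum_norm_triangle_le)
    also have "\<dots> \<le> \<eta> * (e / 2) + \<eta> * (e / 2)"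
      using nk(1) \<open>e > 0\<close> by (intro add_mono mult_right_mono) auto
    finally show ?thesis using s(1) by auto
  qed
  then show "\<exists>\<delta>>0. \<exists>\<kappa>>0. \<forall>q\<in>C. sum_norm (q - z0) \<le> \<delta> \<longrightarrow>
      (\<forall>\<eta>\<in>{0..\<kappa>}. \<exists>s\<in>C. sum_norm (s - q - \<eta> *\<^sub>R z) \<le> \<eta> * e)"
    using d \<open>\<kappa> > 0\<close> by (intro exI[of _ "d / 4"] conjI exI[of _ \<kappa>]) auto
qed

section \<open>Measurable selections\<close>

lemma dense_sequence:
  "\<exists>c :: nat \<Rightarrow> 'x::{metric_space, second_countable_topology}. \<forall>x. \<forall>e>0. \<exists>i. dist (c i) x < e"
proof -
  obtain D :: "'x set" where D: "countable D" "\<And>X. open X \<Longrightarrow> X \<noteq> {} \<Longrightarrow> \<exists>d\<in>D. d \<in> X"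
    by (rule countable_dense_setE) blast
  have "D \<noteq> {}" using D(2)[of UNIV] by auto
  have "\<exists>i. dist (from_nat_into D i) x < e" if e: "e > 0" for x e
  proof -
    obtain d where "d \<in> D" "d \<in> ball x e" using D(2)[of "ball x e"] e by (auto simp del: mem_ball simp: not_le)
    then show ?thesis
      using from_nat_into_surj[OF D(1), of d] by (auto simp: dist_commute)
  qed
  then show ?thesis by blast
qed

text \<open>The Kuratowski--Ryll-Nardzewski construction, for a multifunction whose values need not be
  closed.\<close>

lemma measurable_selection_closure:
  fixes F :: "'t \<Rightarrow> 'x::{complete_space, second_countable_topology} set"
  assumes ne: "\<And>t. t \<in> space M \<Longrightarrow> F t \<noteq> {}" and F: "measurable_multifunction M F"
  obtains f where "f \<in> borel_measurable M" and "\<And>t. t \<in> space M \<Longrightarrow> f t \<in> closure (F t)"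
proof -
  have [measurable]: "Measurable.pred M (\<lambda>t. F t \<inter> U \<noteq> {})" if "open U" for U
    using F that by (simp add: measurable_multifunction_def pred_def)
  obtain c :: "nat \<Rightarrow> 'x" where c: "\<And>x e. e > 0 \<Longrightarrow> \<exists>i. dist (c i) x < e"
    using dense_sequence by metis
  define r :: "nat \<Rightarrow> real" where "r n = (1 / 2) ^ n" for n
  have r: "r n > 0" "r (Suc n) = r n / 2" for n by (auto simp: r_def)
  \<comment> \<open>Meeting the previous ball makes the chosen centres a Cauchy sequence, and the
    countable range reduces measurability to that of the indices.\<close>
  define idx where "idx = rec_nat (\<lambda>t. LEAST i. F t \<inter> ball (c i) (r 0) \<noteq> {})
    (\<lambda>n g t. LEAST i. F t \<inter> (ball (c i) (r (Suc n)) \<inter> ball (c (g t)) (r n)) \<noteq> {})"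
  have idx_0: "idx 0 t = (LEAST i. F t \<inter> ball (c i) (r 0) \<noteq> {})" for t
    by (simp add: idx_def)
  have idx_Suc: "idx (Suc n) t =
      (LEAST i. F t \<inter> (ball (c i) (r (Suc n)) \<inter> ball (c (idx n t)) (r n)) \<noteq> {})" for n t
    by (simp add: idx_def)
  have meas_idx: "idx n \<in> measurable M (count_space UNIV)" for n
  proof (induction n)
    case 0
    show ?case unfolding idx_0[abs_def] by measurable
  next
    case (Suc n)
    note Suc[measurable]
    have "Measurable.pred M (\<lambda>t. F t \<inter> (ball (c i) (r (Suc n)) \<inter> ball (c (idx n t)) (r n)) \<noteq> {})" for i
    proof -
      \<comment> \<open>Splitting over the countably many values of \<open>idx n t\<close> replaces
        the moving ball by fixed open sets, the only ones to which measurability of \<open>F\<close>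
        applies.\<close>
      have "Measurable.pred M (\<lambda>t. \<exists>j. idx n t = j \<and>
          F t \<inter> (ball (c i) (r (Suc n)) \<inter> ball (c j) (r n)) \<noteq> {})"
        by measurable auto
      then show ?thesis by simp
    qed
    then show ?case unfolding idx_Suc[abs_def] by measurable
  qed
  have idx_ne: "F t \<inter> ball (c (idx n t)) (r n) \<noteq> {}" if t: "t \<in> space M" for n t
  proof (induction n)
    case 0
    obtain z where z: "z \<in> F t" using ne[OF t] by blast
    obtain i where "dist (c i) z < r 0" using c r by blast
    then have "F t \<inter> ball (c i) (r 0) \<noteq> {}" using z by auto
    then show ?case unfolding idx_0 by (rule LeastI)
  next
    case (Suc n)
    then obtain z where z: "z \<in> F t" "z \<in> ball (c (idx n t)) (r n)" by blast
    obtain i where "dist (c i) z < r (Suc n)" using c r by blast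
    then have "F t \<inter> (ball (c i) (r (Suc n)) \<inter> ball (c (idx n t)) (r n)) \<noteq> {}" using z by auto
    then have "F t \<inter> (ball (c (idx (Suc n) t)) (r (Suc n)) \<inter> ball (c (idx n t)) (r n)) \<noteq> {}"
      unfolding idx_Suc by (rule LeastI)
    then show ?case by blast
  qed
  have idx_dist: "dist (c (idx n t)) (c (idx (Suc n) t)) \<le> 2 * r n" if t: "t \<in> space M" for n t
  proof -
    obtain z where z: "z \<in> F t" "z \<in> ball (c (idx n t)) (r n)" using idx_ne[OF t, of n] by blast
    obtain i where "dist (c i) z < r (Suc n)" using c r by blast
    then have "F t \<inter> (ball (c i) (r (Suc n)) \<inter> ball (c (idx n t)) (r n)) \<noteq> {}" using z by auto
    then have "F t \<inter> (ball (c (idx (Suc n) t)) (r (Suc n)) \<inter> ball (c (idx n t)) (r n)) \<noteq> {}"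
      unfolding idx_Suc by (rule LeastI)
    then obtain z' where "dist (c (idx (Suc n) t)) z' < r (Suc n)" "dist (c (idx n t)) z' < r n"
      by auto
    then show ?thesis
      using dist_triangle2[of "c (idx n t)" "c (idx (Suc n) t)" z'] r(1)[of n] r(2)[of n] by linarith
  qed
  \<comment> \<open>Since \<open>r i = 2 * (r i - r (Suc i))\<close>, this is the exact sum of the
    bounds \<open>2 * r i\<close> for \<open>i\<close> from \<open>n\<close> to
    \<open>n + k - 1\<close>.\<close>
  have tele: "dist (c (idx n t)) (c (idx (n + k) t)) \<le> 4 * (r n - r (n + k))"
    if t: "t \<in> space M" for n k t
  proof (induction k)
    case (Suc k)
    have "dist (c (idx n t)) (c (idx (n + Suc k) t)) \<le>
        dist (c (idx n t)) (c (idx (n + k) t)) + dist (c (idx (n + k) t)) (c (idx (Suc (n + k)) t))"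
      by (simp add: dist_triangle)
    also have "\<dots> \<le> 4 * (r n - r (n + k)) + 2 * r (n + k)"
      using Suc idx_dist[OF t] by (intro add_mono)
    finally show ?case using r(2)[of "n + k"] by simp
  qed simp
  have r_lim: "\<exists>n. r n < e" if "e > 0" for e
    unfolding r_def using that by (intro real_arch_pow_inv) auto
  have conv: "convergent (\<lambda>n. c (idx n t))" if t: "t \<in> space M" for t
  proof (rule Cauchy_convergent, rule metric_CauchyI)
    fix e :: real assume "e > 0"
    then obtain n where n: "r n < e / 8" using r_lim[of "e / 8"] by auto
    have near: "dist (c (idx n t)) (c (idx m t)) < e / 2" if "m \<ge> n" for m
      using tele[OF t, of n "m - n"] that r(1)[of m] n by simp
    show "\<exists>N. \<forall>m\<ge>N. \<forall>m'\<ge>N. dist (c (idx m t)) (c (idx m' t)) < e"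
      using near by (meson dist_triangle_half_r)
  qed
  define f where "f t = lim (\<lambda>n. c (idx n t))" for t
  have lim: "(\<lambda>n. c (idx n t)) \<longlonglongrightarrow> f t" if "t \<in> space M" for t
    using conv[OF that] by (simp add: f_def convergent_LIMSEQ_iff)
  show thesis
  proof
    have "(\<lambda>t. c (idx n t)) \<in> borel_measurable M" for n
      using meas_idx[of n] by measurable
    then show "f \<in> borel_measurable M"
      using lim by (rule borel_measurable_LIMSEQ_metric)
    fix t assume t: "t \<in> space M"
    show "f t \<in> closure (F t)"
      unfolding closure_approachable
    proof (intro allI impI)
      fix e :: real assume "e > 0"
      obtain m where m: "\<And>n. n \<ge> m \<Longrightarrow> dist (c (idx n t)) (f t) < e / 2"
        using lim[OF t] \<open>e > 0\<close> by (meson half_gt_zero metric_LIMSEQ_D)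
      obtain n where n: "r n < e / 2" using r_lim[of "e / 2"] \<open>e > 0\<close> by auto
      have "r (max m n) \<le> r n" unfolding r_def by (rule power_decreasing) auto
      moreover obtain z where "z \<in> F t" "dist (c (idx (max m n) t)) z < r (max m n)"
        using idx_ne[OF t, of "max m n"] by auto
      ultimately show "\<exists>z\<in>F t. dist z (f t) < e"
        using m[of "max m n"] n dist_triangle[of z "f t" "c (idx (max m n) t)"]
        by (intro bexI[of _ z]) (auto simp: dist_commute)
    qed
  qed
qed

text \<open>For each ball with centre in a dense sequence and radius \<open>1 / Suc k\<close>,
  select from the part of \<open>S t\<close> in the ball where there is one, and from
  \<open>S t\<close> elsewhere. Openness of the ball keeps the truncated multifunction measurable at
  the price of closed values; a selection of the closure suffices, as it stays in the closed ball
  and, \<open>S t\<close> being closed, in \<open>S t\<close>.\<close>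

lemma castaing_representation:
  fixes S :: "'t \<Rightarrow> 'x::{complete_space, second_countable_topology} set"
  assumes ne: "\<And>t. t \<in> space M \<Longrightarrow> S t \<noteq> {}"
    and closed: "\<And>t. t \<in> space M \<Longrightarrow> closed (S t)"
    and S: "measurable_multifunction M S"
  obtains d :: "nat \<Rightarrow> 't \<Rightarrow> 'x"
  where "\<And>i. d i \<in> borel_measurable M" and "\<And>i t. t \<in> space M \<Longrightarrow> d i t \<in> S t"
    and "\<And>t z e. t \<in> space M \<Longrightarrow> z \<in> S t \<Longrightarrow> e > 0 \<Longrightarrow> \<exists>i. dist (d i t) z < e"
proof -
  obtain c :: "nat \<Rightarrow> 'x" where c: "\<And>x e. e > 0 \<Longrightarrow> \<exists>i. dist (c i) x < e"
    using dense_sequence by metis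
  define F where "F = (\<lambda>(i, k) t. let B = ball (c i) (1 / Suc k) in
    if S t \<inter> B \<noteq> {} then S t \<inter> B else S t)"
  have "\<exists>f. f \<in> borel_measurable M \<and> (\<forall>t\<in>space M. f t \<in> closure (F p t))" for p
  proof -
    obtain i k where p: "p = (i, k)" by force
    define B where "B = ball (c i) (1 / Suc k)"
    have S': "{t \<in> space M. S t \<inter> U \<noteq> {}} \<in> sets M" if "open U" for U
      using S that by (simp add: measurable_multifunction_def)
    have "measurable_multifunction M (F p)"
      unfolding measurable_multifunction_def
    proof (intro allI impI)
      fix U :: "'x set" assume "open U"
      have "F p t = (if S t \<inter> B \<noteq> {} then S t \<inter> B else S t)" for t
        by (simp add: F_def p B_def Let_def)
      then have "{t \<in> space M. F p t \<inter> U \<noteq> {}} = {t \<in> space M. S t \<inter> (B \<inter> U) \<noteq> {}} \<union>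
          ({t \<in> space M. S t \<inter> U \<noteq> {}} - {t \<in> space M. S t \<inter> B \<noteq> {}})"
        by (auto split: if_splits)
      also have "\<dots> \<in> sets M"
        by (intro sets.Un sets.Diff S' open_Int \<open>open U\<close>) (auto simp: B_def)
      finally show "{t \<in> space M. F p t \<inter> U \<noteq> {}} \<in> sets M" .
    qed
    moreover have "F p t \<noteq> {}" if "t \<in> space M" for t
      using ne[OF that] by (auto simp: F_def p Let_def)
    ultimately show ?thesis by (metis measurable_selection_closure)
  qed
  then obtain f where f: "\<And>p. f p \<in> borel_measurable M"
    "\<And>p t. t \<in> space M \<Longrightarrow> f p t \<in> closure (F p t)"
    by metis
  show thesis
  proof
    show "f (prod_decode n) \<in> borel_measurable M" for n by (rule f)
    show "f (prod_decode n) t \<in> S t" if t: "t \<in> space M" for n t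
    proof -
      have "F (prod_decode n) t \<subseteq> S t"
        by (auto simp: F_def Let_def split: prod.splits if_splits)
      then show ?thesis using f(2)[OF t] closure_minimal[OF _ closed[OF t]] by blast
    qed
    show "\<exists>n. dist (f (prod_decode n) t) z < e" if t: "t \<in> space M" and z: "z \<in> S t" and "e > 0" for t z e
    proof -
      obtain k where k: "1 / real (Suc k) < e / 2"
        using nat_approx_posE[of "e / 2"] \<open>e > 0\<close> by auto
      obtain i where i: "dist (c i) z < 1 / real (Suc k)" using c[of "1 / real (Suc k)"] by auto
      have "F (i, k) t \<subseteq> cball (c i) (1 / real (Suc k))"
        using i z by (auto simp: F_def Let_def split: if_splits)
      then have "f (i, k) t \<in> cball (c i) (1 / real (Suc k))"
        using f(2)[OF t, of "(i, k)"] closure_minimal[OF _ closed_cball] by blast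
      then have "dist (f (i, k) t) z < e"
        using i k dist_triangle3[of "f (i, k) t" z "c i"] by simp
      then show ?thesis by (metis prod_encode_inverse)
    qed
  qed
qed

lemma castaing_representation_sum_norm:
  fixes S :: "'t \<Rightarrow> ('y::{banach, second_countable_topology} \<times>
                    'z::{banach, second_countable_topology}) set"
  assumes "\<And>t. t \<in> space M \<Longrightarrow> S t \<noteq> {}" and "\<And>t. t \<in> space M \<Longrightarrow> closed (S t)"
    and "measurable_multifunction M S"
  obtains d :: "nat \<Rightarrow> 't \<Rightarrow> 'y \<times> 'z"
  where "\<And>i. d i \<in> borel_measurable M" and "\<And>i t. t \<in> space M \<Longrightarrow> d i t \<in> S t"
    and "\<And>t z e. t \<in> space M \<Longrightarrow> z \<in> S t \<Longrightarrow> e > 0 \<Longrightarrow> \<exists>i. sum_norm (d i t - z) < e"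
proof -
  obtain d :: "nat \<Rightarrow> 't \<Rightarrow> 'y \<times> 'z" where d: "\<And>i. d i \<in> borel_measurable M"
    "\<And>i t. t \<in> space M \<Longrightarrow> d i t \<in> S t"
    "\<And>t z e. t \<in> space M \<Longrightarrow> z \<in> S t \<Longrightarrow> e > 0 \<Longrightarrow> \<exists>i. dist (d i t) z < e"
    using castaing_representation[OF assms] by blast
  have "\<exists>i. sum_norm (d i t - z) < e" if t: "t \<in> space M" "z \<in> S t" "e > 0" for t z e
  proof -
    obtain i where "dist (d i t) z < e / 2" using d(3)[of t z "e / 2"] t by auto
    then show ?thesis
      using sum_norm_le_norm[of "d i t - z"] by (intro exI[of _ i]) (simp add: dist_norm)
  qed
  with d(1,2) show thesis by (rule that)
qed

section \<open>From tangency in the space of selections to pointwise tangency\<close>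

lemma clarke_tangent_cone_Sel_iff:
  "(u, v) \<in> clarke_tangent_cone (Linf M \<times> L1 M) (LinfL1_norm M) C p0 \<longleftrightarrow>
    (u, v) \<in> Linf M \<times> L1 M \<and> (\<forall>\<epsilon>>0. \<exists>\<delta>>0. \<exists>\<kappa>>0. \<forall>p\<in>C.
      p - p0 \<in> Linf M \<times> L1 M \<longrightarrow> LinfL1_norm M (p - p0) \<le> \<delta> \<longrightarrow>
      (\<forall>\<eta>\<in>{0..\<kappa>}. \<exists>s\<in>C. s - p - \<eta> *\<^sub>R (u, v) \<in> Linf M \<times> L1 M \<and>
        LinfL1_norm M (s - p - \<eta> *\<^sub>R (u, v)) \<le> \<eta> * \<epsilon>))"
  by (rule clarke_tangent_cone_iff[OF subspace_LinfL1 LinfL1_norm_scaleR])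

text \<open>The measurable choice of both inclusions: the first index with the wanted property.
  Where no index has it, \<open>LEAST\<close> is an unspecified index, which does not harm
  measurability.\<close>

lemma borel_measurable_Least_compose:
  fixes d :: "nat \<Rightarrow> 't \<Rightarrow> 'x::topological_space"
  assumes [measurable]: "\<And>i. d i \<in> borel_measurable M" "\<And>i. Measurable.pred M (P i)"
  shows "(\<lambda>t. d (LEAST i. P i t) t) \<in> borel_measurable M"
  by (rule measurable_compose_countable) measurable

text \<open>It suffices to cover the nontangent parameters by countably many measurable null sets
  \<open>A l\<close>, so measurability of tangency itself is not an issue. If \<open>A l\<close> had
  weighted mass \<open>c > 0\<close>, some step of length \<open>\<eta>\<close> would leave an
  \<open>L1\<close> residual above \<open>\<eta> * c / (4 * Suc l)\<close>, twice what tangency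
  allows.\<close>

lemma AE_tangent_of_clarke_tangent_cone_Sel:
  fixes S :: "'t \<Rightarrow> ('y::{banach, second_countable_topology} \<times>
                    'z::{banach, second_countable_topology}) set"
  assumes "sigma_finite_measure M"
    and ne: "\<And>t. t \<in> space M \<Longrightarrow> S t \<noteq> {}"
    and closed: "\<And>t. t \<in> space M \<Longrightarrow> closed (S t)"
    and S: "measurable_multifunction M S"
    and xy: "(x, y) \<in> Sel M S"
    and uv: "(u, v) \<in> clarke_tangent_cone (Linf M \<times> L1 M) (LinfL1_norm M) (Sel M S) (x, y)"
  shows "AE t in M. (u t, v t) \<in> clarke_tangent_cone UNIV sum_norm (S t) (x t, y t)"
proof -
  interpret sigma_finite_measure M by fact
  obtain h :: "'t \<Rightarrow> real" where h [measurable]: "h \<in> borel_measurable M" and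
    h_pos: "\<And>t. h t > 0" and h_le: "\<And>t. h t \<le> 1" and h_int: "integrable M h"
    by (rule obtain_positive_integrable_function) blast
  obtain d :: "nat \<Rightarrow> 't \<Rightarrow> 'y \<times> 'z" where d [measurable]: "\<And>i. d i \<in> borel_measurable M" and
    dS: "\<And>i t. t \<in> space M \<Longrightarrow> d i t \<in> S t" and
    dense: "\<And>t z e. t \<in> space M \<Longrightarrow> z \<in> S t \<Longrightarrow> e > 0 \<Longrightarrow> \<exists>i. sum_norm (d i t - z) < e"
    using castaing_representation_sum_norm[OF ne closed S] by blast
  have xL: "x \<in> Linf M" "y \<in> L1 M" and xyS: "AE t in M. (x t, y t) \<in> S t"
    using xy by (auto simp: Sel_def)
  have uvL: "u \<in> Linf M" "v \<in> L1 M"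
    using uv by (auto simp: clarke_tangent_cone_Sel_iff)
  have [measurable]: "x \<in> borel_measurable M" "y \<in> borel_measurable M"
    "u \<in> borel_measurable M" "v \<in> borel_measurable M"
    using xL uvL by (auto simp: L1_def Linf_measurable)
  define z0 where "z0 t = (x t, y t)" for t
  define z where "z t = (u t, v t)" for t
  have [measurable]: "z0 \<in> borel_measurable M" "z \<in> borel_measurable M"
    unfolding z0_def[abs_def] z_def[abs_def] by (auto intro!: borel_measurable_Pair)
  \<comment> \<open>Scaling the radius by \<open>h t\<close> makes the moved selection close to the
    base one in both norms. The gap is a non-strict inequality for the \<open>d i t\<close>, so it
    passes to every point of \<open>S t\<close> by density.\<close>
  define Q where "Q l m k j t \<longleftrightarrow> sum_norm (d j t - z0 t) < h t / real (Suc m) \<and>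
    (\<forall>i. 1 / (real (Suc l) * real k) \<le> sum_norm (d i t - d j t - (1 / real k) *\<^sub>R z t))" for l m k j t
  have [measurable]: "Measurable.pred M (Q l m k j)" for l m k j
    unfolding Q_def[abs_def] by measurable
  define G where "G l m k = {t \<in> space M. \<exists>j. Q l m k j t}" for l m k
  have G [measurable]: "G l m k \<in> sets M" for l m k
    unfolding G_def by measurable
  \<comment> \<open>The order of quantifiers is the order of later choices: \<open>l\<close> fixes
    the accuracy \<open>e\<close>, tangency returns a radius that fixes \<open>m\<close>, and only
    then is \<open>k\<close> taken large.\<close>
  define A where "A l = {t \<in> space M. \<forall>m. \<exists>k0. \<forall>k\<ge>k0. t \<in> G l m k}" for l
  have A [measurable]: "A l \<in> sets M" for l
    unfolding A_def by measurable
  have cover: "\<exists>l. t \<in> A l"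
    if t: "t \<in> space M" and nt: "z t \<notin> clarke_tangent_cone UNIV sum_norm (S t) (z0 t)" for t
  proof -
    obtain e where "e > 0" and e: "\<And>r. r > 0 \<Longrightarrow> \<exists>k0. \<forall>k\<ge>k0. k > 0 \<longrightarrow>
        (\<exists>q\<in>S t. sum_norm (q - z0 t) < r \<and>
          (\<forall>s\<in>S t. e / real k < sum_norm (s - q - (1 / real k) *\<^sub>R z t)))"
      using nt clarke_tangent_cone_sum_normI[of "S t" "z0 t" "z t"] by (metis not_le)
    obtain l where l: "1 / real (Suc l) < e / 2"
      using nat_approx_posE[of "e / 2"] \<open>e > 0\<close> by auto
    have "\<exists>k0. \<forall>k\<ge>k0. t \<in> G l m k" for m
    proof -
      have "h t / real (Suc m) > 0" using h_pos by simp
      from e[OF this] obtain k0 where k0: "\<And>k. k \<ge> k0 \<Longrightarrow> k > 0 \<Longrightarrow>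
        \<exists>q\<in>S t. sum_norm (q - z0 t) < h t / real (Suc m) \<and>
          (\<forall>s\<in>S t. e / real k < sum_norm (s - q - (1 / real k) *\<^sub>R z t))" by blast
      have "t \<in> G l m k" if k: "k \<ge> max 1 k0" for k
      proof -
        have "k > 0" using k by simp
        obtain q where q: "q \<in> S t" "sum_norm (q - z0 t) < h t / real (Suc m)"
          and far: "\<And>s. s \<in> S t \<Longrightarrow> e / real k < sum_norm (s - q - (1 / real k) *\<^sub>R z t)"
          using k0[of k] k \<open>k > 0\<close> by auto
        \<comment> \<open>The first bound keeps \<open>d j t\<close> inside the open radius; the
          second gives up only half of the gap \<open>e / k\<close> when \<open>q\<close> is
          replaced by \<open>d j t\<close>.\<close>
        define r where "r = min (h t / real (Suc m) - sum_norm (q - z0 t)) (e / (2 * real k))"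
        have "r > 0" using q \<open>e > 0\<close> \<open>k > 0\<close> by (simp add: r_def)
        then obtain j where j: "sum_norm (d j t - q) < r" using dense[OF t q(1)] by blast
        have "sum_norm (d j t - z0 t) < h t / real (Suc m)"
          using sum_norm_triangle[of "d j t - q" "q - z0 t"] j by (simp add: r_def)
        moreover have "1 / (real (Suc l) * real k) \<le> sum_norm (d i t - d j t - (1 / real k) *\<^sub>R z t)" for i
        proof -
          have "1 / (real (Suc l) * real k) = (1 / real (Suc l)) / real k" by simp
          also have "\<dots> \<le> (e / 2) / real k" using l by (intro divide_right_mono) auto
          also have "\<dots> = e / real k - e / (2 * real k)" by (simp add: field_simps)
          also have "\<dots> \<le> sum_norm (d i t - d j t - (1 / real k) *\<^sub>R z t)"
            using far[OF dS[OF t, of i]] j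
              sum_norm_triangle[of "d i t - d j t - (1 / real k) *\<^sub>R z t" "d j t - q"]
            by (simp add: r_def algebra_simps)
          finally show ?thesis .
        qed
        ultimately show ?thesis using t by (auto simp: G_def Q_def)
      qed
      then show ?thesis by blast
    qed
    then show ?thesis using t by (auto simp: A_def)
  qed
  have null: "AE t in M. t \<notin> A l" for l
  proof -
    \<comment> \<open>Weighting by \<open>h\<close> gives a finite mass even if \<open>A l\<close>
      has infinite measure, and this mass vanishes only for a null set.\<close>
    define c where "c = (\<integral>t. h t * indicator (A l) t \<partial>M)"
    have int_ind: "integrable M (\<lambda>t. h t * indicator B t)" if "B \<in> sets M" for B
      using integrable_mult_indicator[OF that h_int] by (simp add: mult.commute)
    have "c = 0"
    proof (rule ccontr)
      assume "c \<noteq> 0"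
      then have "c > 0"
        using h_pos by (simp add: c_def less_le integral_nonneg_AE)
      \<comment> \<open>The first bound prevents the \<open>Linf\<close> residual from covering more
        than half of the gap; the second makes the permitted \<open>L1\<close> residual half of the
        one that is forced.\<close>
      define e where "e = min (1 / (2 * real (Suc l))) (c / (8 * real (Suc l)))"
      have "e > 0" using \<open>c > 0\<close> by (simp add: e_def)
      then obtain \<delta> \<kappa> where "\<delta> > 0" "\<kappa> > 0" and clarke: "\<And>p \<eta>. p \<in> Sel M S \<Longrightarrow>
          p - (x, y) \<in> Linf M \<times> L1 M \<Longrightarrow> LinfL1_norm M (p - (x, y)) \<le> \<delta> \<Longrightarrow> 0 \<le> \<eta> \<Longrightarrow> \<eta> \<le> \<kappa> \<Longrightarrow>
          \<exists>s\<in>Sel M S. s - p - \<eta> *\<^sub>R (u, v) \<in> Linf M \<times> L1 M \<and>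
            LinfL1_norm M (s - p - \<eta> *\<^sub>R (u, v)) \<le> \<eta> * e"
        using uv unfolding clarke_tangent_cone_Sel_iff by (metis atLeastAtMost_iff)
      define I where "I = (\<integral>t. h t \<partial>M)"
      have "I \<ge> 0" using h_pos by (simp add: I_def integral_nonneg_AE less_imp_le)
      obtain m where "1 / real (Suc m) < \<delta> / (1 + I)"
        using nat_approx_posE[of "\<delta> / (1 + I)"] \<open>\<delta> > 0\<close> \<open>I \<ge> 0\<close> by auto
      then have m: "1 / real (Suc m) + I / real (Suc m) \<le> \<delta>"
        using \<open>I \<ge> 0\<close> by (simp add: field_simps)
      \<comment> \<open>With \<open>m\<close> fixed, each point of \<open>A l\<close> lies in
        \<open>G l m k\<close> for all large \<open>k\<close>; so a single step length
        \<open>1 / k\<close> is bad on a set carrying more than half of the mass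
        \<open>c\<close>.\<close>
      have "(\<lambda>k. \<integral>t. h t * indicator (G l m k \<inter> A l) t \<partial>M) \<longlonglongrightarrow> c"
        unfolding c_def
      proof (rule integral_dominated_convergence[OF _ _ h_int])
        show "AE t in M. (\<lambda>k. h t * indicator (G l m k \<inter> A l) t) \<longlonglongrightarrow> h t * indicator (A l) t"
        proof (rule AE_I2)
          fix t assume t: "t \<in> space M"
          have "\<forall>\<^sub>F k in sequentially. indicator (G l m k \<inter> A l) t = (indicator (A l) t :: real)"
          proof (cases "t \<in> A l")
            case True
            then obtain k0 where "\<forall>k\<ge>k0. t \<in> G l m k" by (auto simp: A_def)
            then show ?thesis
              using True unfolding eventually_sequentially by (intro exI[of _ k0]) simp
          qed auto
          then show "(\<lambda>k. h t * indicator (G l m k \<inter> A l) t) \<longlonglongrightarrow> h t * indicator (A l) t"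
            by (intro tendsto_mult tendsto_const tendsto_eventually)
        qed
        show "AE t in M. norm (h t * indicator (G l m k \<inter> A l) t) \<le> h t" for k
          using h_pos by (auto simp: indicator_def less_imp_le)
      qed measurable
      moreover have "c / 2 < c" using \<open>c > 0\<close> by simp
      ultimately have "\<forall>\<^sub>F k in sequentially. c / 2 < (\<integral>t. h t * indicator (G l m k \<inter> A l) t \<partial>M)"
        by (rule order_tendstoD)
      moreover have "\<forall>\<^sub>F k in sequentially. k > nat \<lceil>1 / \<kappa>\<rceil>"
        by (rule eventually_gt_at_top)
      ultimately have "\<forall>\<^sub>F k in sequentially.
          c / 2 < (\<integral>t. h t * indicator (G l m k \<inter> A l) t \<partial>M) \<and> k > nat \<lceil>1 / \<kappa>\<rceil>"
        by (rule eventually_conj)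
      then obtain k where k: "c / 2 < (\<integral>t. h t * indicator (G l m k \<inter> A l) t \<partial>M)"
        "k > nat \<lceil>1 / \<kappa>\<rceil>"
        using eventually_happens'[OF sequentially_bot] by blast
      have "k > 0" using k(2) by simp
      have "1 / \<kappa> < real k" using k(2) by linarith
      then have k\<kappa>: "1 / real k \<le> \<kappa>" using \<open>\<kappa> > 0\<close> \<open>k > 0\<close> by (simp add: field_simps)
      define \<eta> where "\<eta> = 1 / real k"
      have "\<eta> > 0" using \<open>k > 0\<close> by (simp add: \<eta>_def)
      define p where "p t = (if t \<in> G l m k then d (LEAST j. Q l m k j t) t else z0 t)" for t
      have p_meas [measurable]: "p \<in> borel_measurable M"
        unfolding p_def[abs_def] using borel_measurable_Least_compose[of d M "Q l m k"]
        by measurable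
      have pQ: "Q l m k (LEAST j. Q l m k j t) t" if "t \<in> G l m k" for t
        using that by (auto simp: G_def intro: LeastI)
      have near: "sum_norm (p t - z0 t) \<le> h t / real (Suc m)" for t
        using pQ[of t] h_pos[of t] by (simp add: p_def Q_def less_imp_le)
      have pS: "AE t in M. p t \<in> S t"
        using xyS by (rule AE_mp) (auto simp: p_def z0_def dS)
      define a where "a t = fst (p t)" for t
      define b where "b t = snd (p t)" for t
      have ab_meas [measurable]: "a \<in> borel_measurable M" "b \<in> borel_measurable M"
        unfolding a_def[abs_def] b_def[abs_def]
        by (intro measurable_compose[OF p_meas] borel_measurable_continuous_onI continuous_intros)+
      have norms: "norm ((a - x) t) \<le> 1 / real (Suc m)" "norm ((b - y) t) \<le> h t / real (Suc m)" for t
      proof -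
        have "norm ((a - x) t) \<le> h t / real (Suc m)"
          using norm_fst_le_sum_norm[of "p t - z0 t"] near[of t] by (simp add: a_def z0_def)
        also have "\<dots> \<le> 1 / real (Suc m)" using h_le by (simp add: divide_right_mono)
        finally show "norm ((a - x) t) \<le> 1 / real (Suc m)" .
        show "norm ((b - y) t) \<le> h t / real (Suc m)"
          using norm_snd_le_sum_norm[of "p t - z0 t"] near[of t] by (simp add: b_def z0_def)
      qed
      have ax: "a - x \<in> Linf M" "Linf_norm M (a - x) \<le> 1 / real (Suc m)"
        using norms by (auto intro!: Linf_bound simp: fun_diff_def)
      have by_int: "integrable M (b - y)"
        by (rule Bochner_Integration.integrable_bound[of M "\<lambda>t. h t / real (Suc m)"])
          (use h_int norms h_pos in \<open>auto simp: fun_diff_def less_imp_le\<close>)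
      have "L1_norm M (b - y) \<le> (\<integral>t. h t / real (Suc m) \<partial>M)"
        unfolding L1_norm_def
        by (intro integral_mono integrable_norm by_int integrable_divide h_int norms)
      then have "L1_norm M (b - y) \<le> I / real (Suc m)" by (simp add: I_def)
      then have "LinfL1_norm M ((a, b) - (x, y)) \<le> \<delta>"
        using ax m by (simp add: LinfL1_norm_def)
      moreover have abL: "(a, b) - (x, y) \<in> Linf M \<times> L1 M"
        using ax by_int by (simp add: L1_def)
      moreover have "(a, b) \<in> Sel M S"
      proof -
        have "((a, b) - (x, y)) + (x, y) \<in> Linf M \<times> L1 M"
          using abL xL by (intro subspace_add[OF subspace_LinfL1]) auto
        then show ?thesis using pS by (simp add: Sel_def a_def b_def)
      qed
      ultimately obtain s where s: "s \<in> Sel M S" "s - (a, b) - \<eta> *\<^sub>R (u, v) \<in> Linf M \<times> L1 M"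
        "LinfL1_norm M (s - (a, b) - \<eta> *\<^sub>R (u, v)) \<le> \<eta> * e"
        using clarke[of "(a, b)" \<eta>] k\<kappa> \<open>\<eta> > 0\<close> by (auto simp: \<eta>_def)
      obtain s1 s2 where s12: "s = (s1, s2)" by force
      define D1 where "D1 = s1 - a - \<eta> *\<^sub>R u"
      define D2 where "D2 = s2 - b - \<eta> *\<^sub>R v"
      have D: "D1 \<in> Linf M" "integrable M D2" "Linf_norm M D1 + L1_norm M D2 \<le> \<eta> * e"
        using s by (auto simp: s12 D1_def D2_def L1_def LinfL1_norm_def)
      have sS: "AE t in M. (s1 t, s2 t) \<in> S t" using s(1) by (auto simp: Sel_def s12)
      have low: "AE t in M. \<eta> / (2 * real (Suc l)) * (h t * indicator (G l m k \<inter> A l) t) \<le> norm (D2 t)"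
        using AE_norm_le_Linf_norm[OF D(1)] sS
      proof eventually_elim
        case (elim t)
        show ?case
        proof (cases "t \<in> G l m k")
          case True
          then have t: "t \<in> space M" by (simp add: G_def)
          have "1 / (real (Suc l) * real k) \<le> sum_norm ((s1 t, s2 t) - p t - \<eta> *\<^sub>R z t)"
          \<comment> \<open>The gap is recorded for the points \<open>d i t\<close> only;
            approximating the value of \<open>s\<close> by them extends it to that value.\<close>
          proof (rule field_le_epsilon)
            fix r :: real assume "r > 0"
            then obtain i where i: "sum_norm (d i t - (s1 t, s2 t)) < r"
              using dense[OF t elim(2)] by blast
            have "1 / (real (Suc l) * real k) \<le> sum_norm (d i t - p t - \<eta> *\<^sub>R z t)"
              using pQ[OF True] True by (simp add: Q_def p_def \<eta>_def)
            also have "\<dots> = sum_norm (((s1 t, s2 t) - p t - \<eta> *\<^sub>R z t) + (d i t - (s1 t, s2 t)))"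
              by (simp add: algebra_simps)
            also have "\<dots> \<le> sum_norm ((s1 t, s2 t) - p t - \<eta> *\<^sub>R z t) + r"
              using i by (intro sum_norm_triangle_le) auto
            finally show "1 / (real (Suc l) * real k) \<le>
                sum_norm ((s1 t, s2 t) - p t - \<eta> *\<^sub>R z t) + r" .
          qed
          also have "\<dots> = norm (D1 t) + norm (D2 t)"
            by (simp add: sum_norm_def D1_def D2_def a_def b_def z_def scaleR_fun_def)
          finally have "\<eta> / real (Suc l) \<le> norm (D1 t) + norm (D2 t)"
            by (simp add: \<eta>_def field_simps)
          moreover have "norm (D1 t) \<le> \<eta> * e"
            using elim(1) D(3) L1_norm_nonneg[of M D2] by linarith
          moreover have "\<eta> * e \<le> \<eta> * (1 / (2 * real (Suc l)))"
            using \<open>\<eta> > 0\<close> by (intro mult_left_mono) (auto simp: e_def)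
          moreover have "\<eta> * (1 / (2 * real (Suc l))) = \<eta> / real (Suc l) - \<eta> / (2 * real (Suc l))"
            by (simp add: field_simps del: of_nat_Suc)
          ultimately have "\<eta> / (2 * real (Suc l)) \<le> norm (D2 t)" by simp
          moreover have "\<eta> / (2 * real (Suc l)) * (h t * indicator (G l m k \<inter> A l) t) \<le>
              \<eta> / (2 * real (Suc l)) * 1"
            using h_le[of t] h_pos[of t] \<open>\<eta> > 0\<close> by (intro mult_left_mono) (auto simp: indicator_def)
          ultimately show ?thesis by simp
        qed simp
      qed
      have "\<eta> / (2 * real (Suc l)) * (c / 2) <
          \<eta> / (2 * real (Suc l)) * (\<integral>t. h t * indicator (G l m k \<inter> A l) t \<partial>M)"
        using k(1) \<open>\<eta> > 0\<close> by (intro mult_strict_left_mono) auto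
      also have "\<dots> = (\<integral>t. \<eta> / (2 * real (Suc l)) * (h t * indicator (G l m k \<inter> A l) t) \<partial>M)"
        by simp
      also have "\<dots> \<le> L1_norm M D2"
        unfolding L1_norm_def using low D(2)
        by (intro integral_mono_AE integrable_mult_right int_ind integrable_norm) auto
      also have "\<dots> \<le> \<eta> * e" using D(3) Linf_norm_nonneg[of M D1] by linarith
      also have "\<dots> \<le> \<eta> * (c / (8 * real (Suc l)))"
        using \<open>\<eta> > 0\<close> by (intro mult_left_mono) (auto simp: e_def)
      also have "\<dots> \<le> \<eta> / (2 * real (Suc l)) * (c / 2)"
        using \<open>\<eta> > 0\<close> \<open>c > 0\<close> by (simp add: field_simps del: of_nat_Suc)
      finally show False by simp
    qed
    then have "AE t in M. h t * indicator (A l) t = 0"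
      unfolding c_def using h_pos
      by (subst (asm) integral_nonneg_eq_0_iff_AE[OF int_ind]) (auto simp: less_imp_le)
    then show ?thesis
      by (rule AE_mp) (use h_pos in \<open>auto simp: indicator_def less_le split: if_splits\<close>)
  qed
  have "AE t in M. \<forall>l. t \<notin> A l" using null by (simp add: AE_all_countable)
  then have "AE t in M. z t \<in> clarke_tangent_cone UNIV sum_norm (S t) (z0 t)"
    by (rule AE_mp) (rule AE_I2, use cover in blast)
  then show ?thesis by (simp add: z_def z0_def)
qed

section \<open>Equi-integrability\<close>

text \<open>Needed because the set where a selection is far from the base one varies with the
  selection and is controlled only through its measure. If the claim failed along sets
  \<open>A n\<close> of measure below \<open>(1 / 2) ^ n\<close>, the unions of their tails would
  decrease to \<open>limsup A\<close>, null by Borel-Cantelli, against equi-integrability.\<close>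

lemma equi_integrable_small_sets:
  assumes K: "equi_integrable M K" and "e > 0"
  obtains r :: real where "r > 0" and "\<And>A k. A \<in> sets M \<Longrightarrow> emeasure M A < ennreal r \<Longrightarrow> k \<in> K \<Longrightarrow>
    (\<integral>\<^sup>+t\<in>A. ennreal (norm (k t)) \<partial>M) \<le> e"
proof (rule ccontr)
  assume "\<not> thesis"
  have "\<exists>A k. A \<in> sets M \<and> emeasure M A < ennreal ((1 / 2) ^ n) \<and> k \<in> K \<and>
      e < (\<integral>\<^sup>+t\<in>A. ennreal (norm (k t)) \<partial>M)" for n :: nat
  proof (rule ccontr)
    assume no: "\<not> ?thesis"
    have thesis by (rule that[of "(1 / 2) ^ n"]) (use no in \<open>auto simp: not_less\<close>)
    with \<open>\<not> thesis\<close> show False ..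
  qed
  then obtain A k where A [measurable]: "\<And>n::nat. A n \<in> sets M" and
    small: "\<And>n. emeasure M (A n) < ennreal ((1 / 2) ^ n)" and k: "\<And>n. k n \<in> K" and
    big: "\<And>n. e < (\<integral>\<^sup>+t\<in>A n. ennreal (norm (k n t)) \<partial>M)"
    by metis
  define B where "B n = (\<Union>j\<in>{n..}. A j)" for n
  have "limsup A \<in> null_sets M"
  proof (rule borel_cantelli_limsup1)
    show "emeasure M (A n) < \<infinity>" for n
      using less_trans[OF small[of n] ennreal_less_top] by simp
    have "measure M (A n) \<le> (1 / 2) ^ n" for n
      unfolding measure_def using small[of n] by (intro enn2real_leI) auto
    then show "summable (\<lambda>n. measure M (A n))"
      by (intro summable_comparison_test'[OF summable_geometric[of "1 / 2 :: real"], of 0]) simp_all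
  qed simp
  moreover have "limsup A = (\<Inter>n. B n)"
    by (simp add: limsup_INF_SUP B_def)
  moreover have "decseq B"
    by (rule decseq_SucI) (force simp: B_def)
  moreover have "range B \<subseteq> sets M" by (auto simp: B_def)
  ultimately have "(\<lambda>n. SUP k\<in>K. \<integral>\<^sup>+t\<in>B n. ennreal (norm (k t)) \<partial>M) \<longlonglongrightarrow> 0"
    using K by (auto simp: equi_integrable_def)
  then have "\<forall>\<^sub>F n in sequentially. (SUP k\<in>K. \<integral>\<^sup>+t\<in>B n. ennreal (norm (k t)) \<partial>M) < e"
    using \<open>e > 0\<close> by (rule order_tendstoD)
  then obtain n where n: "(SUP k\<in>K. \<integral>\<^sup>+t\<in>B n. ennreal (norm (k t)) \<partial>M) < e"
    using eventually_happens'[OF sequentially_bot] by blast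
  have "e < (\<integral>\<^sup>+t\<in>A n. ennreal (norm (k n t)) \<partial>M)" by (rule big)
  also have "\<dots> \<le> (\<integral>\<^sup>+t\<in>B n. ennreal (norm (k n t)) \<partial>M)"
    by (intro nn_integral_mono) (auto simp: B_def indicator_def)
  also have "\<dots> \<le> (SUP k\<in>K. \<integral>\<^sup>+t\<in>B n. ennreal (norm (k t)) \<partial>M)"
    using k by (rule SUP_upper)
  finally show False using n by simp
qed

text \<open>Dominated convergence. It lets the direction \<open>v\<close> be estimated by the same
  two smallness statements as the errors in \<open>K\<close>.\<close>

lemma equi_integrable_singleton:
  assumes "integrable M v"
  shows "equi_integrable M {v}"
  unfolding equi_integrable_def
proof (intro allI impI)
  fix A :: "nat \<Rightarrow> 'a set"
  assume "range A \<subseteq> sets M \<and> decseq A \<and> (\<Inter>n. A n) \<in> null_sets M"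
  then have A [measurable]: "\<And>n. A n \<in> sets M" and "decseq A" and null: "(\<Inter>n. A n) \<in> null_sets M"
    by auto
  have v [measurable]: "v \<in> borel_measurable M" using assms by auto
  have "(\<lambda>n. \<integral>\<^sup>+t\<in>A n. ennreal (norm (v t)) \<partial>M) \<longlonglongrightarrow> (\<integral>\<^sup>+t. 0 \<partial>M)"
  proof (rule nn_integral_dominated_convergence)
    show "(\<integral>\<^sup>+t. ennreal (norm (v t)) \<partial>M) < \<infinity>"
      using assms by (simp add: integrable_iff_bounded)
    show "AE t in M. ennreal (norm (v t)) * indicator (A n) t \<le> ennreal (norm (v t))" for n
      by (auto simp: indicator_def)
    show "AE t in M. (\<lambda>n. ennreal (norm (v t)) * indicator (A n) t) \<longlonglongrightarrow> 0"
      using AE_not_in[OF null]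
    proof eventually_elim
      case (elim t)
      then obtain n where "t \<notin> A n" by blast
      then have "t \<notin> A m" if "m \<ge> n" for m using \<open>decseq A\<close> that by (auto simp: decseq_def)
      then have "\<forall>\<^sub>F m in sequentially. ennreal (norm (v t)) * indicator (A m) t = 0"
        unfolding eventually_sequentially by (intro exI[of _ n]) simp
      then show ?case by (rule tendsto_eventually)
    qed
  qed measurable
  then show "(\<lambda>n. SUP k\<in>{v}. \<integral>\<^sup>+t\<in>A n. ennreal (norm (k t)) \<partial>M) \<longlonglongrightarrow> 0"
    by simp
qed

lemma U_setI:
  assumes u: "u \<in> Linf M" and "Linf_norm M u \<le> m" and "m > 0" and "v \<in> L1 M"
    and "AE t in M. (u t, v t) \<in> clarke_tangent_cone UNIV sum_norm (S t) (x t, y t)"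
  shows "u \<in> U_set M S x y m"
proof -
  have "u \<in> ball_on (Linf M) (Linf_norm M) 0 m"
    using assms by (subst mem_ball_on_iff[OF subspace_Linf]) (auto simp: Linf_norm_scaleR)
  then show ?thesis using assms by (auto simp: U_set_def)
qed

section \<open>Parameters admitting uniform pointwise steps\<close>

text \<open>Only rational steps and points of the sequence \<open>d\<close> occur here, which makes the set measurable;
  by density all steps from all points of \<open>S t\<close> follow, with twice the error.\<close>

definition good_steps ::
  "'t measure \<Rightarrow> (nat \<Rightarrow> 't \<Rightarrow> 'y::real_normed_vector \<times> 'z::real_normed_vector) \<Rightarrow>
    ('t \<Rightarrow> 'y \<times> 'z) \<Rightarrow> ('t \<Rightarrow> 'y \<times> 'z) \<Rightarrow> ('t \<Rightarrow> real) \<Rightarrow> nat \<Rightarrow> 't set" where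
  "good_steps M d z0 z h n = {t \<in> space M. \<forall>r::rat. \<forall>j.
    0 < r \<longrightarrow> of_rat r \<le> 1 / real (Suc n) \<longrightarrow> sum_norm (d j t - z0 t) < 1 / real (Suc n) \<longrightarrow>
    (\<exists>i. sum_norm (d i t - d j t - of_rat r *\<^sub>R z t) < of_rat r * h t)}"

lemma good_steps_measurable:
  fixes d :: "nat \<Rightarrow> 't \<Rightarrow> 'y::{banach, second_countable_topology} \<times>
                    'z::{banach, second_countable_topology}"
  assumes [measurable]: "\<And>i. d i \<in> borel_measurable M" "z0 \<in> borel_measurable M"
    "z \<in> borel_measurable M" "h \<in> borel_measurable M"
  shows "good_steps M d z0 z h n \<in> sets M"
  unfolding good_steps_def by measurable

lemma incseq_good_steps: "incseq (good_steps M d z0 z h)"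
proof (rule incseq_SucI)
  fix n
  have "1 / real (Suc (Suc n)) \<le> 1 / real (Suc n)" by (simp add: field_simps)
  then have le: "a \<le> 1 / real (Suc (Suc n)) \<Longrightarrow> a \<le> 1 / real (Suc n)"
    "a < 1 / real (Suc (Suc n)) \<Longrightarrow> a < 1 / real (Suc n)" for a
    by linarith+
  show "good_steps M d z0 z h n \<subseteq> good_steps M d z0 z h (Suc n)"
    unfolding good_steps_def using le by (intro Collect_mono) meson
qed

text \<open>Tangency is applied with tolerance \<open>h t / 2\<close>; the other half pays for
  replacing the point of \<open>S t\<close> so obtained by some \<open>d i t\<close>. One
  \<open>n\<close> serves as bound for both the radius and the step length.\<close>

lemma tangent_imp_good_steps:
  assumes t: "t \<in> space M" and "z t \<in> clarke_tangent_cone UNIV sum_norm (S t) (z0 t)"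
    and dS: "\<And>i. d i t \<in> S t" and dense: "\<And>q e. q \<in> S t \<Longrightarrow> e > 0 \<Longrightarrow> \<exists>i. sum_norm (d i t - q) < e"
    and "h t > 0"
  shows "\<exists>n. t \<in> good_steps M d z0 z h n"
proof -
  obtain \<delta> \<kappa> where "\<delta> > 0" "\<kappa> > 0" and step: "\<And>q \<eta>. q \<in> S t \<Longrightarrow> sum_norm (q - z0 t) \<le> \<delta> \<Longrightarrow>
      0 \<le> \<eta> \<Longrightarrow> \<eta> \<le> \<kappa> \<Longrightarrow> \<exists>s\<in>S t. sum_norm (s - q - \<eta> *\<^sub>R z t) \<le> \<eta> * (h t / 2)"
    using assms(2) half_gt_zero[OF \<open>h t > 0\<close>] unfolding clarke_tangent_cone_sum_norm_iff
    by (metis atLeastAtMost_iff)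
  obtain n where n: "1 / real (Suc n) < min \<delta> \<kappa>"
    using nat_approx_posE[of "min \<delta> \<kappa>"] \<open>\<delta> > 0\<close> \<open>\<kappa> > 0\<close> by auto
  have "\<exists>i. sum_norm (d i t - d j t - r *\<^sub>R z t) < r * h t"
    if r: "0 < r" "r \<le> 1 / real (Suc n)" and j: "sum_norm (d j t - z0 t) < 1 / real (Suc n)" for r j
  proof -
    obtain s where s: "s \<in> S t" "sum_norm (s - d j t - r *\<^sub>R z t) \<le> r * (h t / 2)"
      using step[OF dS[of j], of r] r j n by auto
    obtain i where i: "sum_norm (d i t - s) < r * (h t / 2)"
      using dense[OF s(1), of "r * (h t / 2)"] r \<open>h t > 0\<close> by auto
    have "sum_norm ((d i t - s) + (s - d j t - r *\<^sub>R z t)) < r * h t"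
      using sum_norm_triangle[of "d i t - s" "s - d j t - r *\<^sub>R z t"] s(2) i by linarith
    then have "sum_norm (d i t - d j t - r *\<^sub>R z t) < r * h t" by (simp add: algebra_simps)
    then show ?thesis by blast
  qed
  then show ?thesis using t by (intro exI[of _ n]) (auto simp: good_steps_def)
qed

lemma good_steps_real_step:
  assumes t: "t \<in> good_steps M d z0 z h n"
    and dense: "\<And>q e. q \<in> S t \<Longrightarrow> e > 0 \<Longrightarrow> \<exists>i. sum_norm (d i t - q) < e"
    and "h t > 0" and q: "q \<in> S t" "sum_norm (q - z0 t) < 1 / real (Suc n)"
    and \<eta>: "0 < \<eta>" "\<eta> \<le> 1 / real (Suc n)"
  shows "\<exists>i. sum_norm (d i t - q - \<eta> *\<^sub>R z t) < \<eta> * (2 * h t)"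
proof -
  \<comment> \<open>The extra error \<open>\<eta> * h t\<close> is split in two: one
    \<open>\<tau>\<close> for moving from \<open>q\<close> to \<open>d j t\<close>, one for
    replacing \<open>\<eta>\<close> by a rational \<open>r\<close> below it.\<close>
  define \<tau> where "\<tau> = \<eta> * h t / 2"
  have "\<tau> > 0" using \<eta> \<open>h t > 0\<close> by (simp add: \<tau>_def)
  \<comment> \<open>The maximum makes the rational step positive, and \<open>1 +\<close> avoids
    division by zero when \<open>z t = 0\<close>.\<close>
  have "max 0 (\<eta> - \<tau> / (1 + sum_norm (z t))) < \<eta>"
    using \<eta> \<open>\<tau> > 0\<close> by (simp add: add_pos_nonneg)
  then obtain r' :: rat where r': "max 0 (\<eta> - \<tau> / (1 + sum_norm (z t))) < of_rat r'" "of_rat r' < \<eta>"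
    using of_rat_dense by blast
  define r :: real where "r = of_rat r'"
  have r: "0 < r" "\<eta> - \<tau> / (1 + sum_norm (z t)) < r" "r < \<eta>" using r' by (auto simp: r_def)
  have "(\<eta> - r) * sum_norm (z t) \<le> \<tau> / (1 + sum_norm (z t)) * sum_norm (z t)"
    using r by (intro mult_right_mono) auto
  also have "\<dots> \<le> \<tau>"
    using \<open>\<tau> > 0\<close> sum_norm_nonneg[of "z t"] by (simp add: field_simps add_pos_nonneg)
  finally have rz: "sum_norm ((r - \<eta>) *\<^sub>R z t) \<le> \<tau>"
    using r by (simp add: sum_norm_scaleR)
  obtain j where j: "sum_norm (d j t - q) < min \<tau> (1 / real (Suc n) - sum_norm (q - z0 t))"
    using dense[OF q(1), of "min \<tau> (1 / real (Suc n) - sum_norm (q - z0 t))"] \<open>\<tau> > 0\<close> q(2) by auto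
  have "sum_norm (d j t - z0 t) < 1 / real (Suc n)"
    using sum_norm_triangle[of "d j t - q" "q - z0 t"] j by simp
  then obtain i where i: "sum_norm (d i t - d j t - r *\<^sub>R z t) < r * h t"
    using t r \<eta> unfolding good_steps_def r_def by force
  have "sum_norm ((d i t - d j t - r *\<^sub>R z t) + ((d j t - q) + (r - \<eta>) *\<^sub>R z t)) \<le> r * h t + (\<tau> + \<tau>)"
    using i j rz by (intro sum_norm_triangle_le) auto
  also have "(d i t - d j t - r *\<^sub>R z t) + ((d j t - q) + (r - \<eta>) *\<^sub>R z t) = d i t - q - \<eta> *\<^sub>R z t"
    by (simp add: algebra_simps)
  also have "r * h t + (\<tau> + \<tau>) < \<eta> * (2 * h t)"
    using r \<open>h t > 0\<close> by (simp add: \<tau>_def)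
  finally show ?thesis by blast
qed

section \<open>From pointwise tangency to tangency in the space of selections\<close>

text \<open>Half of the error \<open>\<eta> * e\<close> is spent on the pointwise corrections, half
  on the set where (V) supplies the correction. All thresholds are fixed before the selection
  \<open>p\<close> and the step \<open>\<eta>\<close> appear, which is possible because the integral
  bounds hold for all of \<open>K\<close> at once.\<close>

lemma AE_tangent_imp_clarke_tangent_cone_Sel:
  fixes S :: "'t \<Rightarrow> ('y::{banach, second_countable_topology} \<times>
                    'z::{banach, second_countable_topology}) set"
  assumes "sigma_finite_measure M"
    and ne: "\<And>t. t \<in> space M \<Longrightarrow> S t \<noteq> {}"
    and closed: "\<And>t. t \<in> space M \<Longrightarrow> closed (S t)"
    and S: "measurable_multifunction M S"
    and xy: "(x, y) \<in> Sel M S"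
    and V: "condition_V M S x y"
    and uvL: "u \<in> Linf M" "v \<in> L1 M"
    and tangent: "AE t in M. (u t, v t) \<in> clarke_tangent_cone UNIV sum_norm (S t) (x t, y t)"
  shows "(u, v) \<in> clarke_tangent_cone (Linf M \<times> L1 M) (LinfL1_norm M) (Sel M S) (x, y)"
  unfolding clarke_tangent_cone_Sel_iff
proof (intro conjI allI impI)
  show "(u, v) \<in> Linf M \<times> L1 M" using uvL by simp
next
  fix e :: real assume "e > 0"
  interpret sigma_finite_measure M by fact
  obtain h :: "'t \<Rightarrow> real" where h [measurable]: "h \<in> borel_measurable M" and
    h_pos: "\<And>t. h t > 0" and h_le: "\<And>t. h t \<le> 1" and h_int: "integrable M h"
    by (rule obtain_positive_integrable_function) blast
  obtain d :: "nat \<Rightarrow> 't \<Rightarrow> 'y \<times> 'z" where d [measurable]: "\<And>i. d i \<in> borel_measurable M" and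
    dS: "\<And>i t. t \<in> space M \<Longrightarrow> d i t \<in> S t" and
    dense: "\<And>t z e. t \<in> space M \<Longrightarrow> z \<in> S t \<Longrightarrow> e > 0 \<Longrightarrow> \<exists>i. sum_norm (d i t - z) < e"
    using castaing_representation_sum_norm[OF ne closed S] by blast
  have xL: "x \<in> Linf M" "y \<in> L1 M" using xy by (auto simp: Sel_def)
  have [measurable]: "x \<in> borel_measurable M" "y \<in> borel_measurable M"
    "u \<in> borel_measurable M" "v \<in> borel_measurable M"
    using xL uvL by (auto simp: L1_def Linf_measurable)
  define z0 where "z0 t = (x t, y t)" for t
  define z where "z t = (u t, v t)" for t
  have [measurable]: "z0 \<in> borel_measurable M" "z \<in> borel_measurable M"
    unfolding z0_def[abs_def] z_def[abs_def] by (auto intro!: borel_measurable_Pair)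

  \<comment> \<open>Adding 1 keeps the bound positive, as (V) demands, even if \<open>u\<close>
    vanishes.\<close>
  define m where "m = Linf_norm M u + 1"
  have m: "m > 0" by (simp add: m_def add_nonneg_pos)
  have uU: "u \<in> U_set M S x y m"
    using uvL tangent m by (intro U_setI) (auto simp: m_def)
  obtain \<delta>0 \<kappa>0 K where "\<delta>0 > 0" "\<kappa>0 > 0" and KL: "K \<subseteq> L1 M" and K: "equi_integrable M K"
    and V': "\<forall>\<eta>\<in>{0..\<kappa>0}. {p + \<eta> *\<^sub>R (u, 0) | p u.
              p \<in> Sel M S \<inter> ball_on (Linf M \<times> L1 M) (LinfL1_norm M) (x, y) \<delta>0 \<and>
              u \<in> U_set M S x y m}
           \<subseteq> {q - \<eta> *\<^sub>R (0, k) | q k. q \<in> Sel M S \<and> k \<in> K}"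
    using V[unfolded condition_V_def, rule_format, OF m] by (elim exE conjE) (rule that; assumption)
  have near_xy: "p \<in> ball_on (Linf M \<times> L1 M) (LinfL1_norm M) (x, y) \<delta>0"
    if "p - (x, y) \<in> Linf M \<times> L1 M" "LinfL1_norm M (p - (x, y)) \<le> \<delta>0" for p
    using that \<open>\<delta>0 > 0\<close> by (subst mem_ball_on_iff[OF subspace_LinfL1]) (auto simp: LinfL1_norm_scaleR)

  define I where "I = (\<integral>t. h t \<partial>M)"
  have "I \<ge> 0" using h_pos by (simp add: I_def integral_nonneg_AE less_imp_le)
  \<comment> \<open>On good parameters the error is at most \<open>2 * e' * h t\<close> per unit
    step, hence \<open>2 * e'\<close> in \<open>Linf\<close> and \<open>2 * e' * I\<close> in
    \<open>L1\<close>, together \<open>e / 2\<close>.\<close>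
  define e' where "e' = e / (4 * (1 + I))"
  have "e' > 0" using \<open>e > 0\<close> \<open>I \<ge> 0\<close> by (simp add: e'_def)
  have e'I: "2 * e' * (1 + I) = e / 2" using \<open>I \<ge> 0\<close> by (simp add: e'_def field_simps)
  \<comment> \<open>One eighth, because four integrals share the other \<open>e / 2\<close>: those
    of \<open>k\<close> and of \<open>v\<close>, each over \<open>N n\<close> and over
    \<open>C\<close>.\<close>
  define E where "E = ennreal (e / 8)"
  have "E > 0" using \<open>e > 0\<close> by (simp add: E_def)

  define W where "W = good_steps M d z0 z (\<lambda>t. e' * h t)"
  have W [measurable]: "W n \<in> sets M" for n
    unfolding W_def by (rule good_steps_measurable) measurable
  have W_cover: "AE t in M. \<exists>n. t \<in> W n"
    using tangent AE_space
  proof eventually_elim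
    case (elim t)
    show ?case
      unfolding W_def
    proof (rule tangent_imp_good_steps)
      show "z t \<in> clarke_tangent_cone UNIV sum_norm (S t) (z0 t)"
        using elim by (simp add: z_def z0_def)
      show "0 < e' * h t" using \<open>e' > 0\<close> h_pos by simp
    qed (use elim dS dense in blast)+
  qed
  define N where "N n = space M - W n" for n
  have N [measurable]: "N n \<in> sets M" for n by (simp add: N_def)
  have "decseq N"
    using incseq_good_steps[of M d z0 z "\<lambda>t. e' * h t"]
    by (auto simp: N_def W_def incseq_def decseq_def)
  moreover have "(\<Inter>n. N n) \<in> null_sets M"
  proof (subst AE_iff_null_sets)
    show "(\<Inter>n. N n) \<in> sets M" by measurable
    show "AE t in M. t \<notin> (\<Inter>n. N n)" using W_cover by eventually_elim (auto simp: N_def)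
  qed
  \<comment> \<open>Here equi-integrability is used along the decreasing sequence \<open>N\<close>.
    The form with "eventually" allows a common \<open>n\<close> for \<open>K\<close> and
    \<open>{v}\<close>.\<close>
  ultimately have tail: "\<forall>\<^sub>F n in sequentially. \<forall>k\<in>L. (\<integral>\<^sup>+t\<in>N n. ennreal (norm (k t)) \<partial>M) \<le> E"
    if "equi_integrable M L" for L :: "('t \<Rightarrow> 'z) set"
  proof -
    have "range N \<subseteq> sets M \<and> decseq N \<and> (\<Inter>n. N n) \<in> null_sets M"
      using \<open>decseq N\<close> \<open>(\<Inter>n. N n) \<in> null_sets M\<close> N by (intro conjI image_subsetI)
    then have "(\<lambda>n. SUP k\<in>L. \<integral>\<^sup>+t\<in>N n. ennreal (norm (k t)) \<partial>M) \<longlonglongrightarrow> 0"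
      by (rule that[unfolded equi_integrable_def, rule_format])
    then have "\<forall>\<^sub>F n in sequentially. (SUP k\<in>L. \<integral>\<^sup>+t\<in>N n. ennreal (norm (k t)) \<partial>M) < E"
      using \<open>E > 0\<close> by (rule order_tendstoD)
    then show ?thesis
    proof eventually_elim
      case (elim n)
      show ?case by (intro ballI less_imp_le SUP_lessD[OF elim])
    qed
  qed
  have v_equi: "equi_integrable M {v}"
    using uvL by (intro equi_integrable_singleton) (simp add: L1_def)
  obtain n where n: "\<forall>k\<in>K. (\<integral>\<^sup>+t\<in>N n. ennreal (norm (k t)) \<partial>M) \<le> E"
    "\<forall>k\<in>{v}. (\<integral>\<^sup>+t\<in>N n. ennreal (norm (k t)) \<partial>M) \<le> E"
    using eventually_happens'[OF sequentially_bot eventually_conj[OF tail[OF K] tail[OF v_equi]]]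
    by blast
  obtain r1 where "r1 > 0" and r1: "\<And>A k. A \<in> sets M \<Longrightarrow> emeasure M A < ennreal r1 \<Longrightarrow> k \<in> K \<Longrightarrow>
      (\<integral>\<^sup>+t\<in>A. ennreal (norm (k t)) \<partial>M) \<le> E"
    by (rule equi_integrable_small_sets[OF K \<open>E > 0\<close>]) blast
  obtain r2 where "r2 > 0" and r2: "\<And>A k. A \<in> sets M \<Longrightarrow> emeasure M A < ennreal r2 \<Longrightarrow> k \<in> {v} \<Longrightarrow>
      (\<integral>\<^sup>+t\<in>A. ennreal (norm (k t)) \<partial>M) \<le> E"
    by (rule equi_integrable_small_sets[OF v_equi \<open>E > 0\<close>]) blast
  define \<rho> where "\<rho> = 1 / real (Suc n)"
  have "\<rho> > 0" by (simp add: \<rho>_def)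
  define r where "r = min r1 r2"
  have "r > 0" using \<open>r1 > 0\<close> \<open>r2 > 0\<close> by (simp add: r_def)
  \<comment> \<open>With \<open>Linf\<close> distance at most \<open>\<rho> / 4\<close>, a total
    distance of \<open>\<rho>\<close> at \<open>t\<close> forces
    \<open>norm (b t - y t) \<ge> \<rho> / 2\<close>; by Markov and the \<open>L1\<close> bound
    \<open>\<rho> * r / 4\<close> this happens on a set of measure at most
    \<open>r / 2\<close>.\<close>
  define \<delta> where "\<delta> = min \<delta>0 (min (\<rho> / 4) (\<rho> * r / 4))"
  have \<delta>_le: "\<delta> \<le> \<rho> / 4" "\<delta> \<le> \<rho> * r / 4" by (simp_all add: \<delta>_def)
  \<comment> \<open>\<open>\<kappa>0\<close> admits the step in (V), \<open>\<rho>\<close> admits it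
    in the pointwise correction.\<close>
  define \<kappa> where "\<kappa> = min \<kappa>0 \<rho>"
  have "\<delta> > 0" using \<open>\<delta>0 > 0\<close> \<open>\<rho> > 0\<close> \<open>r > 0\<close> by (simp add: \<delta>_def)
  have "\<kappa> > 0" using \<open>\<kappa>0 > 0\<close> \<open>\<rho> > 0\<close> by (simp add: \<kappa>_def)

  have main: "\<exists>s\<in>Sel M S. s - p - \<eta> *\<^sub>R (u, v) \<in> Linf M \<times> L1 M \<and>
      LinfL1_norm M (s - p - \<eta> *\<^sub>R (u, v)) \<le> \<eta> * e"
    if p: "p \<in> Sel M S" "p - (x, y) \<in> Linf M \<times> L1 M" "LinfL1_norm M (p - (x, y)) \<le> \<delta>"
      and \<eta>: "\<eta> \<in> {0..\<kappa>}" for p \<eta>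
  proof (cases "\<eta> = 0")
    case True
    have "LinfL1_norm M (0 *\<^sub>R (u, v)) = \<bar>0\<bar> * LinfL1_norm M (u, v)"
      using uvL by (intro LinfL1_norm_scaleR) simp
    then show ?thesis
      using True p(1) subspace_0[OF subspace_Linf[of M]] subspace_0[OF subspace_L1[of M]]
      by (intro bexI[of _ p]) (simp_all add: zero_prod_def)
  next
    case False
    with \<eta> have "\<eta> > 0" "\<eta> \<le> \<kappa>0" "\<eta> \<le> \<rho>" by (auto simp: \<kappa>_def)
    obtain a b where ab: "p = (a, b)" by force
    have abL: "a \<in> Linf M" "b \<in> L1 M" and abS: "AE t in M. (a t, b t) \<in> S t"
      using p(1) by (auto simp: ab Sel_def)
    have [measurable]: "a \<in> borel_measurable M" "b \<in> borel_measurable M"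
      using abL by (auto simp: L1_def Linf_measurable)
    have ax: "a - x \<in> Linf M" "b - y \<in> L1 M" "Linf_norm M (a - x) + L1_norm M (b - y) \<le> \<delta>"
      using p(2,3) by (auto simp: ab LinfL1_norm_def)
    have "p + \<eta> *\<^sub>R (u, 0) \<in> {q - \<eta> *\<^sub>R (0, k) | q k. q \<in> Sel M S \<and> k \<in> K}"
    proof (rule subsetD[OF bspec[OF V']])
      have "p \<in> Sel M S \<inter> ball_on (Linf M \<times> L1 M) (LinfL1_norm M) (x, y) \<delta>0"
        using p near_xy by (auto simp: \<delta>_def)
      then show "p + \<eta> *\<^sub>R (u, 0) \<in> {p + \<eta> *\<^sub>R (u, 0) | p u.
              p \<in> Sel M S \<inter> ball_on (Linf M \<times> L1 M) (LinfL1_norm M) (x, y) \<delta>0 \<and>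
              u \<in> U_set M S x y m}"
        using uU by blast
    qed (use \<open>\<eta> > 0\<close> \<open>\<eta> \<le> \<kappa>0\<close> in auto)
    then obtain q k where q: "q \<in> Sel M S" "p + \<eta> *\<^sub>R (u, 0) = q - \<eta> *\<^sub>R (0, k)" and "k \<in> K"
      by blast
    have "q = p + \<eta> *\<^sub>R (u, 0) + \<eta> *\<^sub>R (0, k)" using q(2) by simp
    then have q_eq: "q = (a + \<eta> *\<^sub>R u, b + \<eta> *\<^sub>R k)" by (simp add: ab)
    have qS: "AE t in M. (a t + \<eta> *\<^sub>R u t, b t + \<eta> *\<^sub>R k t) \<in> S t"
      using q(1) by (simp add: q_eq Sel_def scaleR_fun_def)
    have k_int: "integrable M k" using KL \<open>k \<in> K\<close> by (auto simp: L1_def)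
    then have [measurable]: "k \<in> borel_measurable M" by auto

    define G where "G = {t \<in> space M. t \<in> W n \<and> sum_norm ((a t, b t) - z0 t) < \<rho>}"
    have G [measurable]: "G \<in> sets M"
      unfolding G_def by measurable
    define P where "P i t \<longleftrightarrow> sum_norm (d i t - (a t, b t) - \<eta> *\<^sub>R z t) < \<eta> * (2 * (e' * h t))" for i t
    have [measurable]: "Measurable.pred M (P i)" for i
      unfolding P_def[abs_def] by measurable
    \<comment> \<open>Off \<open>G\<close> the selection given by (V) is used: its residual is zero
      in \<open>Y\<close> and \<open>\<eta> *\<^sub>R (k t - v t)\<close> in \<open>Z\<close>. On
      \<open>G\<close> every \<open>d i t\<close> lies in \<open>S t\<close>, and \<open>P\<close>
      controls the error.\<close>
    define s where "s t = (if t \<in> G then d (LEAST i. P i t) t else (a t + \<eta> *\<^sub>R u t, b t + \<eta> *\<^sub>R k t))" for t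
    have s_meas [measurable]: "s \<in> borel_measurable M"
      unfolding s_def[abs_def] using borel_measurable_Least_compose[of d M P]
      by measurable
    have sS: "AE t in M. s t \<in> S t"
      using qS AE_space by eventually_elim (auto simp: s_def dS)
    have close: "AE t in M. t \<in> G \<longrightarrow> sum_norm (s t - (a t, b t) - \<eta> *\<^sub>R z t) \<le> \<eta> * (2 * (e' * h t))"
      using abS
    proof eventually_elim
      case (elim t)
      show ?case
      proof
        assume t: "t \<in> G"
        then have "t \<in> space M" "t \<in> W n" "sum_norm ((a t, b t) - z0 t) < 1 / real (Suc n)"
          by (auto simp: G_def \<rho>_def)
        then have "\<exists>i. P i t"
          unfolding P_def W_def using elim \<open>\<eta> > 0\<close> \<open>\<eta> \<le> \<rho>\<close> dense \<open>e' > 0\<close> h_pos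
          by (intro good_steps_real_step) (auto simp: \<rho>_def)
        then have "P (LEAST i. P i t) t" by (rule LeastI_ex)
        then show "sum_norm (s t - (a t, b t) - \<eta> *\<^sub>R z t) \<le> \<eta> * (2 * (e' * h t))"
          using t by (simp add: s_def P_def)
      qed
    qed
    define D1 where "D1 t = fst (s t) - a t - \<eta> *\<^sub>R u t" for t
    define D2 where "D2 t = snd (s t) - b t - \<eta> *\<^sub>R v t" for t
    have D_meas [measurable]: "D1 \<in> borel_measurable M" "D2 \<in> borel_measurable M"
    proof -
      have "(\<lambda>t. fst (s t)) \<in> borel_measurable M" "(\<lambda>t. snd (s t)) \<in> borel_measurable M"
        by (intro measurable_compose[OF s_meas] borel_measurable_continuous_onI continuous_intros)+
      then show "D1 \<in> borel_measurable M" "D2 \<in> borel_measurable M"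
        unfolding D1_def[abs_def] D2_def[abs_def] by measurable
    qed
    have D_G: "AE t in M. t \<in> G \<longrightarrow> norm (D1 t) \<le> \<eta> * (2 * (e' * h t)) \<and> norm (D2 t) \<le> \<eta> * (2 * (e' * h t))"
      using close
    proof eventually_elim
      case (elim t)
      then show ?case
        using norm_fst_le_sum_norm[of "s t - (a t, b t) - \<eta> *\<^sub>R z t"]
          norm_snd_le_sum_norm[of "s t - (a t, b t) - \<eta> *\<^sub>R z t"]
        by (auto simp: D1_def D2_def z_def)
    qed
    have "AE t in M. norm (D1 t) \<le> \<eta> * (2 * e')"
      using D_G
    proof eventually_elim
      case (elim t)
      have le: "\<eta> * (2 * (e' * h t)) \<le> \<eta> * (2 * e')"
        using \<open>\<eta> > 0\<close> \<open>e' > 0\<close> h_le[of t] by simp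
      show ?case
      proof (cases "t \<in> G")
        case True
        with elim have "norm (D1 t) \<le> \<eta> * (2 * (e' * h t))" by blast
        then show ?thesis using le by linarith
      next
        case False
        then show ?thesis using \<open>\<eta> > 0\<close> \<open>e' > 0\<close> by (simp add: D1_def s_def)
      qed
    qed
    then have D1: "D1 \<in> Linf M" "Linf_norm M D1 \<le> \<eta> * (2 * e')"
      using \<open>\<eta> > 0\<close> \<open>e' > 0\<close> by (auto intro!: Linf_bound)

    define B where "B = space M - G"
    have B [measurable]: "B \<in> sets M" by (simp add: B_def)
    \<comment> \<open>This is the set where \<open>norm (b t - y t) \<ge> \<rho> / 2\<close>, in the
      form required by Markov's inequality.\<close>
    define C where "C = {t \<in> space M. 1 \<le> ennreal (2 / \<rho>) * ennreal (norm (b t - y t))}"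
    have C [measurable]: "C \<in> sets M" unfolding C_def by measurable
    have "emeasure M C \<le> ennreal (2 / \<rho>) * (\<integral>\<^sup>+t. ennreal (norm (b t - y t)) * indicator (space M) t \<partial>M)"
      unfolding C_def by (rule nn_integral_Markov_inequality) auto
    also have "(\<integral>\<^sup>+t. ennreal (norm (b t - y t)) * indicator (space M) t \<partial>M) = (\<integral>\<^sup>+t. ennreal (norm ((b - y) t)) \<partial>M)"
      by (intro nn_integral_cong) simp
    also have "\<dots> = ennreal (L1_norm M (b - y))"
      unfolding L1_norm_def using ax(2)
      by (intro nn_integral_eq_integral integrable_norm) (simp_all add: L1_def del: minus_apply)
    also have "ennreal (2 / \<rho>) * \<dots> = ennreal (2 / \<rho> * L1_norm M (b - y))"
      using \<open>\<rho> > 0\<close> by (intro ennreal_mult[symmetric]) auto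
    also have "\<dots> < ennreal r"
    proof (rule ennreal_lessI)
      have "L1_norm M (b - y) \<le> \<rho> * r / 4"
        using ax(3) Linf_norm_nonneg[of M "a - x"] \<delta>_le(2) by linarith
      then have "2 / \<rho> * L1_norm M (b - y) \<le> 2 / \<rho> * (\<rho> * r / 4)"
        using \<open>\<rho> > 0\<close> by (intro mult_left_mono) auto
      also have "\<dots> < r" using \<open>\<rho> > 0\<close> \<open>r > 0\<close> by simp
      finally show "2 / \<rho> * L1_norm M (b - y) < r" .
    qed (fact \<open>r > 0\<close>)
    finally have C_small: "emeasure M C < ennreal r" .
    have BNC: "AE t in M. t \<in> B \<longrightarrow> t \<in> N n \<or> t \<in> C"
      using AE_norm_le_Linf_norm[OF ax(1)]
    proof eventually_elim
      case (elim t)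
      have "norm (a t - x t) \<le> \<rho> / 4"
        using elim ax(3) L1_norm_nonneg[of M "b - y"] \<delta>_le(1) unfolding minus_apply by linarith
      then have "norm (b t - y t) \<ge> \<rho> / 2" if "sum_norm ((a t, b t) - z0 t) \<ge> \<rho>"
        using that \<open>\<rho> > 0\<close> by (simp add: sum_norm_def z0_def)
      then have "1 \<le> ennreal (2 / \<rho>) * ennreal (norm (b t - y t))" if "sum_norm ((a t, b t) - z0 t) \<ge> \<rho>"
        using that \<open>\<rho> > 0\<close> by (simp flip: ennreal_mult ennreal_1 add: ennreal_le_iff field_simps)
      then show ?case by (auto simp: B_def G_def N_def C_def)
    qed
    have bad: "(\<integral>\<^sup>+t. ennreal (norm (w t)) * indicator B t \<partial>M) \<le> E + E"
      if [measurable]: "w \<in> borel_measurable M" and "(\<integral>\<^sup>+t\<in>N n. ennreal (norm (w t)) \<partial>M) \<le> E"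
        "(\<integral>\<^sup>+t\<in>C. ennreal (norm (w t)) \<partial>M) \<le> E" for w :: "'t \<Rightarrow> 'z"
    proof -
      have "(\<integral>\<^sup>+t. ennreal (norm (w t)) * indicator B t \<partial>M) \<le>
          (\<integral>\<^sup>+t. ennreal (norm (w t)) * indicator (N n) t + ennreal (norm (w t)) * indicator C t \<partial>M)"
        using BNC by (intro nn_integral_mono_AE, eventually_elim) (auto simp: indicator_def)
      also have "\<dots> = (\<integral>\<^sup>+t\<in>N n. ennreal (norm (w t)) \<partial>M) + (\<integral>\<^sup>+t\<in>C. ennreal (norm (w t)) \<partial>M)"
        by (rule nn_integral_add) measurable
      also have "\<dots> \<le> E + E" using that by (intro add_mono)
      finally show ?thesis .
    qed
    have "emeasure M C < ennreal r1" "emeasure M C < ennreal r2"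
      using C_small by (auto intro: less_le_trans[OF _ ennreal_leI] simp: r_def)
    then have bad_k: "(\<integral>\<^sup>+t. ennreal (norm (k t)) * indicator B t \<partial>M) \<le> E + E"
      and bad_v: "(\<integral>\<^sup>+t. ennreal (norm (v t)) * indicator B t \<partial>M) \<le> E + E"
      using n \<open>k \<in> K\<close> r1[OF C, of k] r2[OF C, of v] by (auto intro!: bad)
    have "(\<integral>\<^sup>+t. ennreal (norm (D2 t)) \<partial>M) \<le> (\<integral>\<^sup>+t. ennreal (\<eta> * (2 * e')) * ennreal (h t) +
        ennreal \<eta> * (ennreal (norm (k t)) * indicator B t + ennreal (norm (v t)) * indicator B t) \<partial>M)"
    proof (rule nn_integral_mono_AE)
      show "AE t in M. ennreal (norm (D2 t)) \<le> ennreal (\<eta> * (2 * e')) * ennreal (h t) +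
        ennreal \<eta> * (ennreal (norm (k t)) * indicator B t + ennreal (norm (v t)) * indicator B t)"
        using D_G AE_space
      proof eventually_elim
        case (elim t)
        show ?case
        proof (cases "t \<in> G")
          case True
          then have "ennreal (norm (D2 t)) \<le> ennreal (\<eta> * (2 * (e' * h t)))"
            using elim by (intro ennreal_leI) simp
          also have "\<dots> = ennreal (\<eta> * (2 * e')) * ennreal (h t)"
            using \<open>\<eta> > 0\<close> \<open>e' > 0\<close> h_pos[of t] by (simp add: ennreal_mult[symmetric] mult.assoc)
          finally show ?thesis by (rule order_trans) simp
        next
          case False
          then have "t \<in> B" using elim by (simp add: B_def)
          have "norm (D2 t) = \<eta> * norm (k t - v t)"
            using False \<open>\<eta> > 0\<close> by (simp add: D2_def s_def flip: scaleR_diff_right)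
          also have "\<dots> \<le> \<eta> * (norm (k t) + norm (v t))"
            using \<open>\<eta> > 0\<close> by (intro mult_left_mono norm_triangle_ineq4) auto
          finally have "ennreal (norm (D2 t)) \<le> ennreal (\<eta> * (norm (k t) + norm (v t)))"
            by (rule ennreal_leI)
          also have "\<dots> = ennreal \<eta> * (ennreal (norm (k t)) + ennreal (norm (v t)))"
            using \<open>\<eta> > 0\<close> by (simp add: ennreal_mult)
          finally show ?thesis using \<open>t \<in> B\<close> by (simp add: add_increasing)
        qed
      qed
    qed
    also have "\<dots> = ennreal (\<eta> * (2 * e')) * (\<integral>\<^sup>+t. ennreal (h t) \<partial>M) + ennreal \<eta> *
        ((\<integral>\<^sup>+t. ennreal (norm (k t)) * indicator B t \<partial>M) + (\<integral>\<^sup>+t. ennreal (norm (v t)) * indicator B t \<partial>M))"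
      by (simp add: nn_integral_add nn_integral_cmult)
    also have "(\<integral>\<^sup>+t. ennreal (h t) \<partial>M) = ennreal I"
      unfolding I_def using h_int h_pos by (intro nn_integral_eq_integral) (auto simp: less_imp_le)
    also have "ennreal (\<eta> * (2 * e')) * ennreal I + ennreal \<eta> *
        ((\<integral>\<^sup>+t. ennreal (norm (k t)) * indicator B t \<partial>M) + (\<integral>\<^sup>+t. ennreal (norm (v t)) * indicator B t \<partial>M))
      \<le> ennreal (\<eta> * (2 * e')) * ennreal I + ennreal \<eta> * ((E + E) + (E + E))"
      using bad_k bad_v by (intro add_left_mono mult_left_mono add_mono) auto
    also have "(E + E) + (E + E) = ennreal (e / 2)"
      using \<open>e > 0\<close> by (simp add: E_def flip: ennreal_plus)
    also have "ennreal (\<eta> * (2 * e')) * ennreal I + ennreal \<eta> * ennreal (e / 2) =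
        ennreal (\<eta> * (2 * e') * I + \<eta> * (e / 2))"
    proof -
      have "ennreal (\<eta> * (2 * e')) * ennreal I = ennreal (\<eta> * (2 * e') * I)"
        using \<open>\<eta> > 0\<close> \<open>e' > 0\<close> \<open>I \<ge> 0\<close> by (intro ennreal_mult[symmetric]) auto
      moreover have "ennreal \<eta> * ennreal (e / 2) = ennreal (\<eta> * (e / 2))"
        using \<open>\<eta> > 0\<close> \<open>e > 0\<close> by (intro ennreal_mult[symmetric]) auto
      moreover have "ennreal (\<eta> * (2 * e') * I) + ennreal (\<eta> * (e / 2)) =
          ennreal (\<eta> * (2 * e') * I + \<eta> * (e / 2))"
        using \<open>\<eta> > 0\<close> \<open>e' > 0\<close> \<open>I \<ge> 0\<close> \<open>e > 0\<close> by (intro ennreal_plus[symmetric]) auto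
      ultimately show ?thesis by simp
    qed
    finally have D2_bound: "(\<integral>\<^sup>+t. ennreal (norm (D2 t)) \<partial>M) \<le> ennreal (\<eta> * (2 * e') * I + \<eta> * (e / 2))" .
    \<comment> \<open>Integrability of the glued selection is not known beforehand: the finite bound
      gives it for the residual, and adding \<open>p + \<eta> *\<^sub>R (u, v)\<close> then places
      \<open>s'\<close> in the product space.\<close>
    then have D2_int: "integrable M D2"
      by (intro integrableI_bounded D_meas) (rule le_less_trans, auto)
    have "L1_norm M D2 \<le> \<eta> * (2 * e') * I + \<eta> * (e / 2)"
      unfolding L1_norm_def using D2_bound \<open>\<eta> > 0\<close> \<open>e' > 0\<close> \<open>I \<ge> 0\<close> \<open>e > 0\<close>
      by (intro integral_real_bounded) auto
    then have "Linf_norm M D1 + L1_norm M D2 \<le> \<eta> * (2 * e' * (1 + I)) + \<eta> * (e / 2)"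
      using D1(2) by (simp add: algebra_simps)
    then have le: "LinfL1_norm M (D1, D2) \<le> \<eta> * e"
      unfolding e'I by (simp add: LinfL1_norm_def)
    have DL: "(D1, D2) \<in> Linf M \<times> L1 M" using D1 D2_int by (simp add: L1_def)
    define s' where "s' = ((\<lambda>t. fst (s t)), (\<lambda>t. snd (s t)))"
    have s'_eq: "s' - p - \<eta> *\<^sub>R (u, v) = (D1, D2)"
      by (simp add: s'_def ab D1_def[abs_def] D2_def[abs_def] fun_eq_iff scaleR_fun_def)
    have "s' = (D1, D2) + (p + \<eta> *\<^sub>R (u, v))" using s'_eq by (simp add: algebra_simps)
    also have "\<dots> \<in> Linf M \<times> L1 M"
      using DL abL uvL
      by (intro subspace_add[OF subspace_LinfL1] subspace_scale[OF subspace_LinfL1]) (auto simp: ab)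
    finally have "s' \<in> Sel M S" using sS by (simp add: s'_def Sel_def)
    then show ?thesis using s'_eq le DL by (intro bexI[of _ s']) auto
  qed
  show "\<exists>\<delta>>0. \<exists>\<kappa>>0. \<forall>p\<in>Sel M S. p - (x, y) \<in> Linf M \<times> L1 M \<longrightarrow>
      LinfL1_norm M (p - (x, y)) \<le> \<delta> \<longrightarrow> (\<forall>\<eta>\<in>{0..\<kappa>}. \<exists>s\<in>Sel M S.
        s - p - \<eta> *\<^sub>R (u, v) \<in> Linf M \<times> L1 M \<and> LinfL1_norm M (s - p - \<eta> *\<^sub>R (u, v)) \<le> \<eta> * e)"
    by (rule exI[of _ \<delta>], rule conjI[OF \<open>\<delta> > 0\<close>], rule exI[of _ \<kappa>],
        rule conjI[OF \<open>\<kappa> > 0\<close>], intro ballI impI main)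
qed

theorem proposition2p1:
  fixes M :: "'t measure"
    and S :: "'t \<Rightarrow> ('y::{banach, second_countable_topology} \<times>
                    'z::{banach, second_countable_topology}) set"
    and x :: "'t \<Rightarrow> 'y" and y :: "'t \<Rightarrow> 'z"
  assumes "complete_measure M" and "sigma_finite_measure M"
    and "\<And>t. t \<in> space M \<Longrightarrow> S t \<noteq> {}"
    and "\<And>t. t \<in> space M \<Longrightarrow> closed (S t)"
    and "measurable_multifunction M S"
    and "(x, y) \<in> Sel M S"
    and "condition_V M S x y"
  shows "clarke_tangent_cone (Linf M \<times> L1 M) (LinfL1_norm M) (Sel M S) (x, y) =
         {(u, v) \<in> Linf M \<times> L1 M.
            AE t in M. (u t, v t) \<in> clarke_tangent_cone UNIV sum_norm (S t) (x t, y t)}"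
proof (intro equalityI subrelI)
  fix u v
  assume uv: "(u, v) \<in> clarke_tangent_cone (Linf M \<times> L1 M) (LinfL1_norm M) (Sel M S) (x, y)"
  then have "(u, v) \<in> Linf M \<times> L1 M" unfolding clarke_tangent_cone_Sel_iff by blast
  moreover have "AE t in M. (u t, v t) \<in> clarke_tangent_cone UNIV sum_norm (S t) (x t, y t)"
    using assms(2,3,4,5,6) uv by (rule AE_tangent_of_clarke_tangent_cone_Sel)
  ultimately show "(u, v) \<in> {(u, v) \<in> Linf M \<times> L1 M.
      AE t in M. (u t, v t) \<in> clarke_tangent_cone UNIV sum_norm (S t) (x t, y t)}"
    by simp
next
  fix u v
  assume "(u, v) \<in> {(u, v) \<in> Linf M \<times> L1 M.
      AE t in M. (u t, v t) \<in> clarke_tangent_cone UNIV sum_norm (S t) (x t, y t)}"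
  then show "(u, v) \<in> clarke_tangent_cone (Linf M \<times> L1 M) (LinfL1_norm M) (Sel M S) (x, y)"
    using AE_tangent_imp_clarke_tangent_cone_Sel[OF assms(2,3,4,5,6,7)] by simp
qed

end
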